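(* No infinite torsion group belongs to the class $\mathbf{CF\text{-}TR}$. In particular, the Grigorchuk group is not in $\mathbf{CF\text{-}TR}$.
   Context: Let $A$ be a finite alphabet closed under a formal inversion $a\mapsto a^{-1}$ ($a^{-1}\ne a$, $(a^{-1})^{-1}=a$), $A^*$ the free monoid on $A$, and $F_A$ the free group whose elements are the reduced words over $A$. An $A$-graph is a connected directed graph $\Gamma$ with vertex set $V(\Gamma)$, edges labeled by letters of $A$, and a fixed-point-free involution $e\mapsto e^{-1}$ on edges which exchanges initial and terminal vertices and inverts labels, and which is deterministic: for each vertex $v$ and each $a\in A$ there is at most one edge labeled $a$ starting at $v$. It is complete if for each $v$ and $a$ there is at least one such edge. $L(\Gamma,x)\subseteq A^*$ is the set of labels of circuits at the vertex $x$ (walks from $x$ to $x$). $\Gamma$ is context-free if $L(\Gamma,x_0)$ is a context-free language for some (equivalently, every) vertex $x_0$. For complete $A$-graphs $\Gamma^{(1)},\ldots,\Gamma^{(k)}$ the transition group $\mathcal{G}(\Gamma^{(1)}\sqcup\cdots\sqcup\Gamma^{(k)})$ is the quotient of $F_A$ by the normal subgroup defined by $\bigcap_{i}\bigcap_{p\in V(\Gamma^{(i)})}L(\Gamma^{(i)},p)$; equivalently, it is the group of permutations of the disjoint union of the sets $V(\Gamma^{(i)})$ generated by the permutations induced by the letters of $A$. $\mathbf{CF\text{-}TR}$ is the class of all groups isomorphic to $\mathcal{G}(\Gamma^{(1)}\sqcup\cdots\sqcup\Gamma^{(k)})$ for some finite involutively closed alphabet $A$ and some finite collection of complete context-free $A$-graphs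 $\Gamma^{(1)},\ldots,\Gamma^{(k)}$. The Grigorchuk group is Grigorchuk's (first) infinite finitely generated torsion group of intermediate growth. *)

theory Defs
  imports
    "HOL-Algebra.Coset"
    "HOL-Algebra.Bij"
    "HOL-Algebra.Elementary_Groups"
    "Graph_Theory.Digraph_Component"
begin

section \<open>Context-free languages\<close>

text \<open>
  A sentential form is a list over \<open>nat + 'a\<close>: \<open>Inl N\<close> is a nonterminal and \<open>Inr a\<close> a terminal.
  A grammar is a finite set of productions with a start symbol; since only finitely many
  nonterminals occur in it, naming them by natural numbers is no restriction.
\<close>

type_synonym 'a productions = "(nat \<times> (nat + 'a) list) set"

inductive derives1 :: "'a productions \<Rightarrow> (nat + 'a) list \<Rightarrow> (nat + 'a) list \<Rightarrow> bool"
  for P :: "'a productions"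
  where
    step: "(N, \<gamma>) \<in> P \<Longrightarrow> derives1 P (\<alpha> @ Inl N # \<beta>) (\<alpha> @ \<gamma> @ \<beta>)"

definition grammar_language :: "'a productions \<Rightarrow> nat \<Rightarrow> 'a list set" where
  "grammar_language P S = {w. (derives1 P)\<^sup>*\<^sup>* [Inl S] (map Inr w)}"

definition context_free_language :: "'a list set \<Rightarrow> bool" where
  "context_free_language L \<longleftrightarrow> (\<exists>P S. finite P \<and> L = grammar_language P S)"


section \<open>Involutive alphabets and free groups\<close>

definition involutive_alphabet :: "'a set \<Rightarrow> ('a \<Rightarrow> 'a) \<Rightarrow> bool" where
  "involutive_alphabet A \<iota> \<longleftrightarrow>
     finite A \<and> (\<forall>a\<in>A. \<iota> a \<in> A \<and> \<iota> a \<noteq> a \<and> \<iota> (\<iota> a) = a)"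

definition reduced :: "('a \<Rightarrow> 'a) \<Rightarrow> 'a list \<Rightarrow> bool" where
  "reduced \<iota> w \<longleftrightarrow> \<not> (\<exists>u a v. w = u @ [a, \<iota> a] @ v)"

fun cons_reduce :: "('a \<Rightarrow> 'a) \<Rightarrow> 'a \<Rightarrow> 'a list \<Rightarrow> 'a list" where
  "cons_reduce \<iota> a [] = [a]"
| "cons_reduce \<iota> a (b # w) = (if b = \<iota> a then w else a # b # w)"

definition reduce :: "('a \<Rightarrow> 'a) \<Rightarrow> 'a list \<Rightarrow> 'a list" where
  "reduce \<iota> w = foldr (cons_reduce \<iota>) w []"

text \<open>
  The inverse of the generator \<open>a\<close> is the letter \<open>\<iota> a\<close>, so the rank is half the alphabet size.
\<close>

definition free_group :: "'a set \<Rightarrow> ('a \<Rightarrow> 'a) \<Rightarrow> 'a list monoid" where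
  "free_group A \<iota> =
     \<lparr>carrier = {w \<in> lists A. reduced \<iota> w},
      monoid.mult = (\<lambda>u v. reduce \<iota> (u @ v)),
      one = []\<rparr>"


section \<open>Labelled graphs\<close>

record ('v, 'e, 'a) labelled_graph =
  base :: "('v, 'e) pre_digraph"
  label :: "'e \<Rightarrow> 'a"
  arc_inv :: "'e \<Rightarrow> 'e"

definition A_graph :: "'a set \<Rightarrow> ('a \<Rightarrow> 'a) \<Rightarrow> ('v, 'e, 'a) labelled_graph \<Rightarrow> bool" where
  "A_graph A \<iota> \<Gamma> \<longleftrightarrow>
     wf_digraph (base \<Gamma>) \<and> connected (base \<Gamma>) \<and>
     (\<forall>e \<in> arcs (base \<Gamma>).
        label \<Gamma> e \<in> A \<and>
        arc_inv \<Gamma> e \<in> arcs (base \<Gamma>) \<and> arc_inv \<Gamma> e \<noteq> e \<and> arc_inv \<Gamma> (arc_inv \<Gamma> e) = e \<and>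
        tail (base \<Gamma>) (arc_inv \<Gamma> e) = head (base \<Gamma>) e \<and>
        head (base \<Gamma>) (arc_inv \<Gamma> e) = tail (base \<Gamma>) e \<and>
        label \<Gamma> (arc_inv \<Gamma> e) = \<iota> (label \<Gamma> e)) \<and>
     (\<forall>e \<in> arcs (base \<Gamma>). \<forall>f \<in> arcs (base \<Gamma>).
        tail (base \<Gamma>) e = tail (base \<Gamma>) f \<and> label \<Gamma> e = label \<Gamma> f \<longrightarrow> e = f)"

definition complete_graph :: "'a set \<Rightarrow> ('v, 'e, 'a) labelled_graph \<Rightarrow> bool" where
  "complete_graph A \<Gamma> \<longleftrightarrow>
     (\<forall>v \<in> verts (base \<Gamma>). \<forall>a \<in> A. \<exists>e \<in> arcs (base \<Gamma>). tail (base \<Gamma>) e = v \<and> label \<Gamma> e = a)"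

definition circuit_language :: "('v, 'e, 'a) labelled_graph \<Rightarrow> 'v \<Rightarrow> 'a list set" where
  "circuit_language \<Gamma> x = {map (label \<Gamma>) p |p. pre_digraph.awalk (base \<Gamma>) x p x}"

definition context_free_graph :: "('v, 'e, 'a) labelled_graph \<Rightarrow> bool" where
  "context_free_graph \<Gamma> \<longleftrightarrow>
     (\<exists>x \<in> verts (base \<Gamma>). context_free_language (circuit_language \<Gamma> x))"


section \<open>Transition groups\<close>

text \<open>
  The words over \<open>A\<close> that label a circuit at every vertex of every graph; their reduced forms are
  the elements of the normal subgroup of the free group that this language defines.
\<close>

definition trivial_words ::
    "'a set \<Rightarrow> ('v, 'e, 'a) labelled_graph list \<Rightarrow> 'a list set" where
  "trivial_words A \<Gamma>s =
     {w \<in> lists A. \<forall>\<Gamma> \<in> set \<Gamma>s. \<forall>p \<in> verts (base \<Gamma>). w \<in> circuit_language \<Gamma> p}"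

definition transition_group ::
    "'a set \<Rightarrow> ('a \<Rightarrow> 'a) \<Rightarrow> ('v, 'e, 'a) labelled_graph list \<Rightarrow> 'a list set monoid" where
  "transition_group A \<iota> \<Gamma>s = free_group A \<iota> Mod (reduce \<iota> ` trivial_words A \<Gamma>s)"

text \<open>
  HOL has no quantifier over types, so the types \<open>'a\<close> of letters, \<open>'v\<close> of vertices and \<open>'e\<close> of
  edges are parameters of the class. For arbitrary types this covers every choice of alphabet
  and graphs: finitely many graphs with different vertex or edge types embed into common ones.
\<close>

definition CF_TR ::
    "'a itself \<Rightarrow> 'v itself \<Rightarrow> 'e itself \<Rightarrow> ('g, 'm) monoid_scheme set" where
  "CF_TR _ _ _ =
     {G. group G \<and>
        (\<exists>(A :: 'a set) \<iota> (\<Gamma>s :: ('v, 'e, 'a) labelled_graph list).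
           involutive_alphabet A \<iota> \<and> \<Gamma>s \<noteq> [] \<and>
           (\<forall>\<Gamma> \<in> set \<Gamma>s. A_graph A \<iota> \<Gamma> \<and> complete_graph A \<Gamma> \<and> context_free_graph \<Gamma>) \<and>
           G \<cong> transition_group A \<iota> \<Gamma>s)}"


section \<open>Torsion groups and the Grigorchuk group\<close>

definition torsion_group :: "('g, 'm) monoid_scheme \<Rightarrow> bool" where
  "torsion_group G \<longleftrightarrow>
     group G \<and> (\<forall>x \<in> carrier G. \<exists>n::nat. n > 0 \<and> x [^]\<^bsub>G\<^esub> n = \<one>\<^bsub>G\<^esub>)"

text \<open>
  The generators act on the vertices of the infinite rooted binary tree, that is, on finite
  binary words (\<open>False\<close> is 0, \<open>True\<close> is 1): \<open>a\<close> flips the first letter, and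
  \<open>b = (a, c)\<close>, \<open>c = (a, d)\<close>, \<open>d = (1, b)\<close> fix it and act on the subtrees below 0 and 1.
\<close>

fun grig_a :: "bool list \<Rightarrow> bool list" where
  "grig_a [] = []"
| "grig_a (x # w) = (\<not> x) # w"

fun grig_b :: "bool list \<Rightarrow> bool list"
  and grig_c :: "bool list \<Rightarrow> bool list"
  and grig_d :: "bool list \<Rightarrow> bool list"
  where
    "grig_b [] = []"
  | "grig_b (x # w) = x # (if x then grig_c w else grig_a w)"
  | "grig_c [] = []"
  | "grig_c (x # w) = x # (if x then grig_d w else grig_a w)"
  | "grig_d [] = []"
  | "grig_d (x # w) = x # (if x then grig_b w else w)"

definition grigorchuk_group :: "(bool list \<Rightarrow> bool list) monoid" where
  "grigorchuk_group = subgroup_generated (BijGroup UNIV) {grig_a, grig_b, grig_c, grig_d}"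

end

theory Submission
  imports Defs
begin

text \<open>
Suppose that the torsion group \<open>G\<close> is the transition group of finitely many complete
context-free graphs. An element of \<open>G\<close> acts on all vertices, so every word \<open>w\<close> moves each vertex
\<open>v\<close> through a finite orbit. The heart of the matter is that a context-free graph with this
property is finite (\<open>finite_if_pointwise_torsion\<close>). Then \<open>G\<close> embeds into the permutation group of
a finite set, hence is finite.

Fix the vertex \<open>x0\<close> at which the circuits form a context-free language. For a vertex \<open>y\<close> let
\<open>stay y\<close> be the set of words along which the walk from \<open>y\<close> never gets closer to \<open>x0\<close> than \<open>y\<close>
is; it plays the role of the end-isomorphism types of Muller and Schupp. There are only
finitely many such sets (\<open>finite_stay\<close>), for the following reason. A word \<open>\<gamma>\<close> that starts at \<open>y\<close>,
stays, and ends at the same depth as \<open>y\<close>, can be completed by geodesics to a circuit at \<open>x0\<close>.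
The lowest node of its derivation tree that spans \<open>\<gamma>\<close> has a boundary between two children inside
\<open>\<gamma>\<close>. Replacing the children on one side by bounded words gives a short connection from there to
the end of the span. As all vertices on \<open>\<gamma>\<close> are at least as deep as \<open>y\<close>, the span must begin and
end within bounded distance of the ends of \<open>\<gamma>\<close> (\<open>level_path_decomposition\<close>). So the grammar,
together with finitely much information on the neighbourhood of \<open>y\<close>, determines where \<open>\<gamma>\<close> ends and
which letters lead out from there (\<open>stay_subset\<close>).

If the graph were infinite, a long geodesic from \<open>x0\<close> would contain two vertices \<open>y\<close> and \<open>z\<close>, with
\<open>z\<close> deeper, such that \<open>stay y = stay z\<close>. Let \<open>q\<close> be the label of the segment from \<open>y\<close> to \<open>z\<close>.
Inductively all powers of \<open>q\<close> lie in \<open>stay y = stay z\<close>, so after the first \<open>q\<close> the walk along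
\<open>q q q ...\<close> from \<open>y\<close> remains at least as deep as \<open>z\<close> and never returns to \<open>y\<close>. The orbit of \<open>y\<close>
under \<open>q\<close> is infinite, a contradiction.

For the Grigorchuk group it remains to see that it is an infinite torsion group. Torsion is
proved by the classical contraction: an element is written as a product of factors \<open>a x\<close> with
\<open>x\<close> in the Klein four-group \<open>{1, b, c, d}\<close>, and its restrictions to the two subtrees (or those of
its square) are conjugate to products of the same kind, which become shorter after at most three
such steps (\<open>torsion_alternating\<close>). It is infinite because it acts transitively on every level of
the tree (\<open>level_transitive\<close>).
\<close>

section \<open>Derivations in context-free grammars\<close>

text \<open>
Derivations as trees. Unlike sequences of rewriting steps, they can be analysed by structural
induction, and a word split into consecutive parts is matched by a split of the sentential form.
\<close>

inductive yields :: "'a productions \<Rightarrow> (nat + 'a) list \<Rightarrow> 'a list \<Rightarrow> bool"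
  for P :: "'a productions"
  where
    yields_Nil: "yields P [] []"
  | yields_terminal: "yields P \<phi> w \<Longrightarrow> yields P (Inr a # \<phi>) (a # w)"
  | yields_nonterminal:
      "(N, \<gamma>) \<in> P \<Longrightarrow> yields P \<gamma> u \<Longrightarrow> yields P \<phi> v \<Longrightarrow> yields P (Inl N # \<phi>) (u @ v)"

inductive_cases yields_NilE: "yields P [] w"
inductive_cases yields_terminalE: "yields P (Inr a # \<phi>) w"
inductive_cases yields_nonterminalE: "yields P (Inl N # \<phi>) w"

lemma yields_append:
  assumes "yields P \<phi> u" "yields P \<psi> v"
  shows "yields P (\<phi> @ \<psi>) (u @ v)"
  using assms(1)
proof (induction rule: yields.induct)
  case (yields_nonterminal N \<gamma> u \<phi> w)
  then show ?case using yields.yields_nonterminal[of N \<gamma> P u "\<phi> @ \<psi>" "w @ v"] by simp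
qed (use assms(2) in \<open>auto intro: yields.intros\<close>)

lemma yields_appendE:
  assumes "yields P (\<phi> @ \<psi>) w"
  obtains u v where "w = u @ v" "yields P \<phi> u" "yields P \<psi> v"
  using assms
proof (induction \<phi> arbitrary: w thesis)
  case Nil
  then show ?case by (metis append_Nil yields.yields_Nil)
next
  case (Cons X \<phi>)
  show ?case
  proof (cases X)
    case (Inl N)
    with Cons.prems(2) have "yields P (Inl N # (\<phi> @ \<psi>)) w" by simp
    then obtain \<gamma> x y where *: "w = x @ y" "(N, \<gamma>) \<in> P" "yields P \<gamma> x" "yields P (\<phi> @ \<psi>) y"
      by (elim yields_nonterminalE) blast
    obtain u v where "y = u @ v" "yields P \<phi> u" "yields P \<psi> v"
      using Cons.IH *(4) by blast
    then show ?thesis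
      using Cons.prems(1)[of "x @ u" v] * Inl by (simp add: yields_nonterminal)
  next
    case (Inr a)
    with Cons.prems(2) have "yields P (Inr a # (\<phi> @ \<psi>)) w" by simp
    then obtain y where *: "w = a # y" "yields P (\<phi> @ \<psi>) y"
      by (elim yields_terminalE) blast
    obtain u v where "y = u @ v" "yields P \<phi> u" "yields P \<psi> v"
      using Cons.IH *(2) by blast
    then show ?thesis
      using Cons.prems(1)[of "a # u" v] * Inr by (simp add: yields_terminal)
  qed
qed

lemma yields_terminals: "yields P (map Inr w) w"
  by (induction w) (auto intro: yields.intros)

lemma derives1_context:
  assumes "derives1 P \<phi> \<psi>"
  shows "derives1 P (\<alpha> @ \<phi> @ \<beta>) (\<alpha> @ \<psi> @ \<beta>)"
  using assms
proof cases
  case (step N \<gamma> \<alpha>' \<beta>')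
  then show ?thesis using derives1.step[of N \<gamma> P "\<alpha> @ \<alpha>'" "\<beta>' @ \<beta>"] by simp
qed

lemma derives_context:
  assumes "(derives1 P)\<^sup>*\<^sup>* \<phi> \<psi>"
  shows "(derives1 P)\<^sup>*\<^sup>* (\<alpha> @ \<phi> @ \<beta>) (\<alpha> @ \<psi> @ \<beta>)"
  using assms
proof (induction rule: rtranclp_induct)
  case (step \<psi> \<chi>)
  then show ?case using derives1_context[OF step(2), of \<alpha> \<beta>] by (meson rtranclp.rtrancl_into_rtrancl)
qed simp

lemma derives_production:
  "(N, \<gamma>) \<in> P \<Longrightarrow> (derives1 P)\<^sup>*\<^sup>* (\<alpha> @ Inl N # \<beta>) (\<alpha> @ \<gamma> @ \<beta>)"
  by (blast intro: derives1.step)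

lemma yields_imp_derives: "yields P \<phi> w \<Longrightarrow> (derives1 P)\<^sup>*\<^sup>* \<phi> (map Inr w)"
proof (induction rule: yields.induct)
  case (yields_terminal \<phi> w a)
  then show ?case using derives_context[of P \<phi> "map Inr w" "[Inr a]" "[]"] by simp
next
  case (yields_nonterminal N \<gamma> u \<phi> v)
  have "(derives1 P)\<^sup>*\<^sup>* (Inl N # \<phi>) (\<gamma> @ \<phi>)"
    using derives_production[OF yields_nonterminal(1), of "[]" \<phi>] by simp
  moreover have "(derives1 P)\<^sup>*\<^sup>* (\<gamma> @ \<phi>) (map Inr u @ \<phi>)"
    using derives_context[OF yields_nonterminal(4), of "[]" \<phi>] by simp
  moreover have "(derives1 P)\<^sup>*\<^sup>* (map Inr u @ \<phi>) (map Inr u @ map Inr v)"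
    using derives_context[OF yields_nonterminal(5), of "map Inr u" "[]"] by simp
  ultimately show ?case by simp
qed simp

lemma derives1_yields:
  assumes "derives1 P \<phi> \<psi>" "yields P \<psi> w"
  shows "yields P \<phi> w"
  using assms(1)
proof cases
  case (step N \<gamma> \<alpha> \<beta>)
  obtain u v t where "w = u @ v @ t" "yields P \<alpha> u" "yields P \<gamma> v" "yields P \<beta> t"
    using assms(2) step by (metis yields_appendE)
  then show ?thesis
    using step by (auto intro!: yields_append yields_nonterminal)
qed

lemma derives_yields:
  assumes "(derives1 P)\<^sup>*\<^sup>* \<phi> \<psi>" "yields P \<psi> w"
  shows "yields P \<phi> w"
  using assms by (induction rule: converse_rtranclp_induct) (auto intro: derives1_yields)

lemma grammar_language_yields: "w \<in> grammar_language P S \<longleftrightarrow> yields P [Inl S] w"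
  unfolding grammar_language_def
  using yields_imp_derives derives_yields yields_terminals by fastforce

lemma grammar_language_context:
  assumes "(derives1 P)\<^sup>*\<^sup>* [Inl S] (map Inr u @ \<delta> @ map Inr v)" "yields P \<delta> w"
  shows "u @ w @ v \<in> grammar_language P S"
  unfolding grammar_language_yields
  by (rule derives_yields[OF assms(1)]) (intro yields_append yields_terminals assms(2))

text \<open>
A form yields \<open>u @ \<gamma> @ v\<close> by a derivation in which some boundary between two consecutive pieces
of the form itself, or of the right-hand side of a production that is applied in it, falls
strictly inside \<open>\<gamma>\<close>. In the second case \<open>u2\<close> and \<open>v2\<close> are the parts of the context that are
derived by the same production.
\<close>

inductive cut_inside ::
    "'a productions \<Rightarrow> 'a list \<Rightarrow> (nat + 'a) list \<Rightarrow> 'a list \<Rightarrow> 'a list \<Rightarrow> bool"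
  for P :: "'a productions" and \<gamma> :: "'a list"
  where
    cut_root: "\<lbrakk>yields P \<delta>1 (u @ \<gamma>1); yields P \<delta>2 (\<gamma>2 @ v); \<gamma> = \<gamma>1 @ \<gamma>2; \<gamma>1 \<noteq> []; \<gamma>2 \<noteq> []\<rbrakk>
      \<Longrightarrow> cut_inside P \<gamma> (\<delta>1 @ \<delta>2) u v"
  | cut_below: "\<lbrakk>(N, \<delta>1 @ \<delta>2) \<in> P; (derives1 P)\<^sup>*\<^sup>* \<phi> (map Inr u1 @ (\<delta>1 @ \<delta>2) @ map Inr v1);
      yields P \<delta>1 (u2 @ \<gamma>1); yields P \<delta>2 (\<gamma>2 @ v2); \<gamma> = \<gamma>1 @ \<gamma>2\<rbrakk>
      \<Longrightarrow> cut_inside P \<gamma> \<phi> (u1 @ u2) (v2 @ v1)"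

lemma cut_inside_prepend:
  assumes "cut_inside P \<gamma> \<phi> u v" "yields P \<psi> x"
  shows "cut_inside P \<gamma> (\<psi> @ \<phi>) (x @ u) v"
  using assms(1)
proof cases
  case (cut_root \<delta>1 \<gamma>1 \<delta>2 \<gamma>2)
  then show ?thesis
    using cut_inside.cut_root[of P "\<psi> @ \<delta>1" "x @ u" \<gamma>1 \<delta>2 \<gamma>2 v \<gamma>] yields_append[OF assms(2)]
    by simp
next
  case (cut_below N \<delta>1 \<delta>2 u1 v1 u2 \<gamma>1 \<gamma>2 v2)
  have "(derives1 P)\<^sup>*\<^sup>* (\<psi> @ \<phi>) (\<psi> @ map Inr u1 @ (\<delta>1 @ \<delta>2) @ map Inr v1)"
    using derives_context[OF cut_below(4), of \<psi> "[]"] by simp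
  also have "(derives1 P)\<^sup>*\<^sup>* \<dots> (map Inr x @ map Inr u1 @ (\<delta>1 @ \<delta>2) @ map Inr v1)"
    using derives_context[OF yields_imp_derives[OF assms(2)], of "[]"] by simp
  finally show ?thesis
    using cut_inside.cut_below[OF cut_below(3) _ cut_below(5-7), of "\<psi> @ \<phi>" "x @ u1" v1]
      cut_below(1,2) by simp
qed

lemma cut_inside_production:
  assumes "cut_inside P \<gamma> \<rho> u v" "(N, \<rho>) \<in> P" "yields P \<phi> y"
  shows "cut_inside P \<gamma> (Inl N # \<phi>) u (v @ y)"
proof -
  have start: "(derives1 P)\<^sup>*\<^sup>* (Inl N # \<phi>) (\<rho> @ map Inr y)"
    using derives_production[OF assms(2), of "[]" \<phi>]
      derives_context[OF yields_imp_derives[OF assms(3)], of \<rho> "[]"] by simp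
  from assms(1) show ?thesis
  proof cases
    case (cut_root \<delta>1 \<gamma>1 \<delta>2 \<gamma>2)
    then show ?thesis
      using cut_inside.cut_below[of N \<delta>1 \<delta>2 P "Inl N # \<phi>" "[]" y u \<gamma>1 \<gamma>2 v] start assms(2) by simp
  next
    case (cut_below M \<delta>1 \<delta>2 u1 v1 u2 \<gamma>1 \<gamma>2 v2)
    have "(derives1 P)\<^sup>*\<^sup>* (Inl N # \<phi>) (map Inr u1 @ (\<delta>1 @ \<delta>2) @ map Inr (v1 @ y))"
      using rtranclp_trans[OF start derives_context[OF cut_below(4), of "[]" "map Inr y", simplified]]
      by simp
    then show ?thesis
      using cut_inside.cut_below[OF cut_below(3) _ cut_below(5-7)] cut_below(1,2) by simp
  qed
qed

lemma append_eq_three_cases: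
  assumes "x @ y = u @ \<gamma> @ v"
  obtains (right) u' where "u = x @ u'" "y = u' @ \<gamma> @ v"
    | (left) v' where "x = u @ \<gamma> @ v'" "v = v' @ y"
    | (cut) \<gamma>1 \<gamma>2 where "\<gamma> = \<gamma>1 @ \<gamma>2" "\<gamma>1 \<noteq> []" "\<gamma>2 \<noteq> []" "x = u @ \<gamma>1" "y = \<gamma>2 @ v"
proof -
  from assms consider us where "x = u @ us" "us @ y = \<gamma> @ v" | us where "x @ us = u" "y = us @ \<gamma> @ v"
    unfolding append_eq_append_conv2 by blast
  then show thesis
  proof cases
    case (1 us)
    from 1(2) consider vs where "us = \<gamma> @ vs" "vs @ y = v" | vs where "us @ vs = \<gamma>" "y = vs @ v"
      unfolding append_eq_append_conv2 by blast
    then show thesis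
    proof cases
      case (2 vs)
      then show thesis
        using 1 right[of "[]"] left[of "[]"] cut[of us vs] by (cases "us = []"; cases "vs = []") auto
    qed (use 1 left in auto)
  qed (use right in auto)
qed

text \<open>
Descend in the derivation tree as long as one child spans all of \<open>\<gamma>\<close>. At the last node, the child
that contains the first letter of \<open>\<gamma>\<close> ends inside \<open>\<gamma>\<close>. A single letter could be a leaf of the
tree, which is why two letters are required.
\<close>

lemma yields_cut_inside:
  assumes "yields P \<phi> (u @ \<gamma> @ v)" "length \<gamma> \<ge> 2"
  shows "cut_inside P \<gamma> \<phi> u v"
  using assms(1)
proof (induction \<phi> "u @ \<gamma> @ v" arbitrary: u v rule: yields.induct)
  case yields_Nil
  then show ?case using assms(2) by auto
next
  case (yields_terminal \<phi> w a)
  have a: "yields P [Inr a] [a]" using yields_terminals[of P "[a]"] by simp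
  have "[a] @ w = u @ \<gamma> @ v" using yields_terminal.hyps(3) by simp
  then show ?case
  proof (cases rule: append_eq_three_cases)
    case (right u')
    show ?thesis
      using cut_inside_prepend[OF yields_terminal.hyps(2)[OF right(2)] a] right by simp
  next
    case (left v')
    have "length [a] = length (u @ \<gamma> @ v')" using left(1) by (rule arg_cong)
    then show ?thesis using assms(2) by simp
  next
    case (cut \<gamma>1 \<gamma>2)
    then show ?thesis
      using cut_root[of P "[Inr a]" u \<gamma>1 \<phi> \<gamma>2 v \<gamma>] a yields_terminal.hyps(1) by simp
  qed
next
  case (yields_nonterminal N \<rho> x \<phi> y)
  have N: "yields P [Inl N] x"
    using yields.yields_nonterminal[OF yields_nonterminal.hyps(1,2) yields_Nil] by simp
  from yields_nonterminal.hyps(6) show ?case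
  proof (cases rule: append_eq_three_cases)
    case (right u')
    show ?thesis
      using cut_inside_prepend[OF yields_nonterminal.hyps(5)[OF right(2)] N] right by simp
  next
    case (left v')
    show ?thesis
      using cut_inside_production[OF yields_nonterminal.hyps(3)[OF left(1)]]
        yields_nonterminal.hyps(1,4) left by simp
  next
    case (cut \<gamma>1 \<gamma>2)
    then show ?thesis
      using cut_root[of P "[Inl N]" u \<gamma>1 \<phi> \<gamma>2 v \<gamma>] N yields_nonterminal.hyps(4) by simp
  qed
qed

lemma grammar_language_cut:
  assumes "u @ \<gamma> @ v \<in> grammar_language P S" "length \<gamma> \<ge> 2"
  obtains N \<delta>1 \<delta>2 \<gamma>1 \<gamma>2 u1 u2 v1 v2 where
    "(N, \<delta>1 @ \<delta>2) \<in> P" "\<gamma> = \<gamma>1 @ \<gamma>2" "u = u1 @ u2" "v = v2 @ v1"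
    "(derives1 P)\<^sup>*\<^sup>* [Inl S] (map Inr u1 @ (\<delta>1 @ \<delta>2) @ map Inr v1)"
    "yields P \<delta>1 (u2 @ \<gamma>1)" "yields P \<delta>2 (\<gamma>2 @ v2)"
  using yields_cut_inside[OF assms(1)[unfolded grammar_language_yields] assms(2)]
proof cases
  case (cut_root \<delta>1 \<gamma>1 \<delta>2 \<gamma>2)
  then have "\<delta>1 = [] \<or> \<delta>2 = []" by (cases \<delta>1) auto
  then show ?thesis using cut_root by (auto elim: yields_NilE)
qed (rule that)

lemma finite_short_yields:
  assumes "finite F"
  shows "\<exists>K. \<forall>\<delta>\<in>F. (\<exists>w. yields P \<delta> w) \<longrightarrow> (\<exists>w. yields P \<delta> w \<and> length w \<le> K)"
proof -
  define f where "f \<delta> = length (SOME w. yields P \<delta> w)" for \<delta>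
  have "\<exists>w. yields P \<delta> w \<and> length w \<le> Max (f ` F)" if "\<delta> \<in> F" "yields P \<delta> w" for \<delta> w
    using that assms someI[of "yields P \<delta>" w] Max_ge[of "f ` F" "f \<delta>"] unfolding f_def by blast
  then show ?thesis by blast
qed

text \<open>
The bounded replacements: whatever a prefix or a suffix of a right-hand side derives, it also
derives some word of length at most \<open>K\<close>.
\<close>

definition yield_bound :: "'a productions \<Rightarrow> nat \<Rightarrow> bool" where
  "yield_bound P K \<longleftrightarrow> (\<forall>N \<delta>1 \<delta>2 \<delta> w. (N, \<delta>1 @ \<delta>2) \<in> P \<and> (\<delta> = \<delta>1 \<or> \<delta> = \<delta>2) \<and> yields P \<delta> w
     \<longrightarrow> (\<exists>w'. yields P \<delta> w' \<and> length w' \<le> K))"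

lemma yield_boundE:
  assumes "yield_bound P K" "(N, \<delta>1 @ \<delta>2) \<in> P" "\<delta> = \<delta>1 \<or> \<delta> = \<delta>2" "yields P \<delta> w"
  obtains w' where "yields P \<delta> w'" "length w' \<le> K"
  using assms unfolding yield_bound_def by blast

text \<open>
Right-hand sides have only finitely many prefixes and suffixes.
\<close>

lemma yield_bound_exists:
  assumes "finite P"
  shows "\<exists>K. yield_bound P K"
proof -
  define F where "F = (\<Union>\<delta>\<in>snd ` P. \<Union>n\<le>length \<delta>. {take n \<delta>, drop n \<delta>})"
  have "finite F" using assms unfolding F_def by blast
  then obtain K where K: "\<And>\<delta> w. \<delta> \<in> F \<Longrightarrow> yields P \<delta> w \<Longrightarrow> \<exists>w. yields P \<delta> w \<and> length w \<le> K"
    using finite_short_yields[of F P] by blast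
  have "\<delta>1 \<in> F \<and> \<delta>2 \<in> F" if "(N, \<delta>1 @ \<delta>2) \<in> P" for N \<delta>1 \<delta>2
  proof -
    have "\<delta>1 @ \<delta>2 \<in> snd ` P" using that by force
    moreover have "length \<delta>1 \<le> length (\<delta>1 @ \<delta>2)" "\<delta>1 = take (length \<delta>1) (\<delta>1 @ \<delta>2)"
      "\<delta>2 = drop (length \<delta>1) (\<delta>1 @ \<delta>2)" by auto
    ultimately show ?thesis unfolding F_def by blast
  qed
  then have "yield_bound P K" unfolding yield_bound_def using K by blast
  then show ?thesis by blast
qed


section \<open>Letter actions with a context-free stabiliser language\<close>

lemma finite_image_factor:
  assumes "finite (f ` X)" "\<And>x y. x \<in> X \<Longrightarrow> y \<in> X \<Longrightarrow> f x = f y \<Longrightarrow> g x = g y"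
  shows "finite (g ` X)"
proof -
  have "g ` X \<subseteq> (\<lambda>d. g (SOME x. x \<in> X \<and> f x = d)) ` (f ` X)"
  proof
    fix c assume "c \<in> g ` X"
    then obtain x where x: "x \<in> X" "c = g x" by blast
    then have "(SOME x'. x' \<in> X \<and> f x' = f x) \<in> X \<and> f (SOME x'. x' \<in> X \<and> f x' = f x) = f x"
      by (intro someI[of "\<lambda>x'. x' \<in> X \<and> f x' = f x" x]) simp
    then have "c = g (SOME x'. x' \<in> X \<and> f x' = f x)" using assms(2) x by metis
    then show "c \<in> (\<lambda>d. g (SOME x. x \<in> X \<and> f x = d)) ` (f ` X)" using x by blast
  qed
  then show ?thesis using assms(1) finite_subset by blast
qed

definition inverse_word :: "('a \<Rightarrow> 'a) \<Rightarrow> 'a list \<Rightarrow> 'a list" where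
  "inverse_word \<iota> w = rev (map \<iota> w)"

lemma inverse_word_simps [simp]:
  "inverse_word \<iota> [] = []"
  "inverse_word \<iota> (a # w) = inverse_word \<iota> w @ [\<iota> a]"
  "inverse_word \<iota> (u @ v) = inverse_word \<iota> v @ inverse_word \<iota> u"
  "length (inverse_word \<iota> w) = length w"
  by (simp_all add: inverse_word_def)

lemma inverse_word_lists:
  "involutive_alphabet A \<iota> \<Longrightarrow> w \<in> lists A \<Longrightarrow> inverse_word \<iota> w \<in> lists A"
  unfolding inverse_word_def involutive_alphabet_def by (auto simp: in_lists_conv_set)

locale letter_action =
  fixes A :: "'a set" and \<iota> :: "'a \<Rightarrow> 'a" and V :: "'v set" and step :: "'v \<Rightarrow> 'a \<Rightarrow> 'v"
  assumes alphabet: "involutive_alphabet A \<iota>"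
    and step_closed: "v \<in> V \<Longrightarrow> a \<in> A \<Longrightarrow> step v a \<in> V"
    and step_inverse: "v \<in> V \<Longrightarrow> a \<in> A \<Longrightarrow> step (step v a) (\<iota> a) = v"
begin

abbreviation run :: "'v \<Rightarrow> 'a list \<Rightarrow> 'v" where
  "run \<equiv> foldl step"

lemma run_closed: "v \<in> V \<Longrightarrow> w \<in> lists A \<Longrightarrow> run v w \<in> V"
  by (induction w arbitrary: v) (auto simp: step_closed)

lemma inv_lists: "w \<in> lists A \<Longrightarrow> inverse_word \<iota> w \<in> lists A"
  using alphabet by (rule inverse_word_lists)

lemma run_inverse: "v \<in> V \<Longrightarrow> w \<in> lists A \<Longrightarrow> run (run v w) (inverse_word \<iota> w) = v"
  by (induction w arbitrary: v) (auto simp: step_closed step_inverse)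

lemma run_eqD: "run v w = u \<Longrightarrow> v \<in> V \<Longrightarrow> w \<in> lists A \<Longrightarrow> v = run u (inverse_word \<iota> w)"
  using run_inverse[of v w] by simp

lemma run_inj: "run u w = run v w \<Longrightarrow> u \<in> V \<Longrightarrow> v \<in> V \<Longrightarrow> w \<in> lists A \<Longrightarrow> u = v"
  by (metis run_inverse)

end

locale pointed_letter_action = letter_action +
  fixes x0
  assumes base_point: "x0 \<in> V"
    and reachable_from_base: "v \<in> V \<Longrightarrow> \<exists>w\<in>lists A. run x0 w = v"
begin

definition depth :: "'b \<Rightarrow> nat" where
  "depth v = (LEAST n. \<exists>w\<in>lists A. length w = n \<and> run x0 w = v)"

lemma geodesic_exists:
  assumes "v \<in> V"
  obtains w where "w \<in> lists A" "length w = depth v" "run x0 w = v"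
proof -
  have "\<exists>n. \<exists>w\<in>lists A. length w = n \<and> run x0 w = v"
    using reachable_from_base[OF assms] by blast
  from LeastI_ex[OF this] show thesis using that unfolding depth_def by blast
qed

lemma depth_le: "w \<in> lists A \<Longrightarrow> depth (run x0 w) \<le> length w"
  unfolding depth_def by (rule Least_le) blast

lemma depth_run_le:
  assumes "v \<in> V" "w \<in> lists A"
  shows "depth (run v w) \<le> depth v + length w"
proof -
  obtain p where p: "p \<in> lists A" "length p = depth v" "run x0 p = v"
    using geodesic_exists[OF assms(1)] .
  then show ?thesis using depth_le[of "p @ w"] assms(2) by simp
qed

lemma depth_le_run:
  assumes "v \<in> V" "w \<in> lists A"
  shows "depth v \<le> depth (run v w) + length w"
  using depth_run_le[OF run_closed[OF assms] inv_lists[OF assms(2)]] run_inverse[OF assms] by simp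

lemma geodesic_prefix:
  assumes "p @ q \<in> lists A" "length (p @ q) = depth (run x0 (p @ q))"
  shows "depth (run x0 p) = length p"
  using depth_le[of p] depth_run_le[of "run x0 p" q] assms run_closed[OF base_point, of p] by auto

text \<open>
The words that can be read from \<open>y\<close> without passing through a vertex closer to the base point
than \<open>y\<close>.
\<close>

definition stay :: "'b \<Rightarrow> 'a list set" where
  "stay y = {w \<in> lists A. \<forall>u v. w = u @ v \<longrightarrow> depth y \<le> depth (run y u)}"

lemma stay_prefix: "u @ v \<in> stay y \<Longrightarrow> u \<in> stay y"
  unfolding stay_def by auto

lemma stay_depth: "w \<in> stay y \<Longrightarrow> depth y \<le> depth (run y w)"
  unfolding stay_def by auto

lemma stay_append:
  assumes "u \<in> stay y" "v \<in> stay (run y u)"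
  shows "u @ v \<in> stay y"
proof -
  have uy: "depth y \<le> depth (run y u)" using assms(1) unfolding stay_def by auto
  have "depth y \<le> depth (run y s)" if "u @ v = s @ t" for s t
  proof -
    from that consider r where "u = s @ r" | r where "s = u @ r" "v = r @ t"
      unfolding append_eq_append_conv2 by blast
    then show ?thesis
    proof cases
      case 1
      then show ?thesis using assms(1) unfolding stay_def by blast
    next
      case 2
      then have "depth (run y u) \<le> depth (run (run y u) r)" using assms(2) unfolding stay_def by blast
      then show ?thesis using 2 uy by simp
    qed
  qed
  then show ?thesis using assms unfolding stay_def by auto
qed

lemma depth_step:
  assumes "v \<in> V" "a \<in> A"
  shows "depth (step v a) \<le> Suc (depth v)" "depth v \<le> Suc (depth (step v a))"
  using depth_run_le[of v "[a]"] depth_le_run[of v "[a]"] assms by auto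

end

locale context_free_action = pointed_letter_action +
  fixes P :: "'a productions" and S :: nat
  assumes finite_P: "finite P"
    and circuits: "{w \<in> lists A. run x0 w = x0} = grammar_language P S"
begin

lemma circuit_iff: "w \<in> grammar_language P S \<longleftrightarrow> w \<in> lists A \<and> run x0 w = x0"
  using circuits by blast

text \<open>
Some derivation from the start symbol contains \<open>\<delta>\<close> in such a position that the part of the walk
read by \<open>\<delta>\<close> begins at the vertex from which \<open>u\<close> leads to \<open>y\<close>.
\<close>

definition occurs_before :: "(nat + 'a) list \<Rightarrow> 'a list \<Rightarrow> 'b \<Rightarrow> bool" where
  "occurs_before \<delta> u y \<longleftrightarrow> (\<exists>s t. s \<in> lists A \<and>
     (derives1 P)\<^sup>*\<^sup>* [Inl S] (map Inr s @ \<delta> @ map Inr t) \<and> run x0 (s @ u) = y)"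

text \<open>
All words derived from the same occurrence of \<open>\<delta>\<close> lead to the same vertex, because the rest
\<open>t\<close> of the circuit leads from there to the base point and letters act injectively.
\<close>

lemma context_substitution:
  assumes "(derives1 P)\<^sup>*\<^sup>* [Inl S] (map Inr s @ \<delta> @ map Inr t)" "yields P \<delta> w" "yields P \<delta> w'"
  shows "w \<in> lists A" "run x0 (s @ w) = run x0 (s @ w')" "run x0 (s @ w) = run x0 (inverse_word \<iota> t)"
proof -
  have w: "s @ w @ t \<in> lists A" "run (run x0 (s @ w)) t = x0"
    using grammar_language_context[OF assms(1,2)] unfolding circuit_iff by auto
  have w': "s @ w' @ t \<in> lists A" "run (run x0 (s @ w')) t = x0"
    using grammar_language_context[OF assms(1,3)] unfolding circuit_iff by auto
  show "w \<in> lists A" using w by simp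
  show "run x0 (s @ w) = run x0 (inverse_word \<iota> t)"
    using run_eqD[OF w(2)] w run_closed[OF base_point, of "s @ w"] by simp
  moreover have "run x0 (s @ w') = run x0 (inverse_word \<iota> t)"
    using run_eqD[OF w'(2)] w' run_closed[OF base_point, of "s @ w'"] by simp
  ultimately show "run x0 (s @ w) = run x0 (s @ w')" by simp
qed

text \<open>
The endpoint of \<open>\<gamma>\<close> can be reached from \<open>y\<close> by a word that does not depend on \<open>\<gamma>\<close>: go back along
\<open>u\<close>, follow some fixed word \<open>\<alpha>\<close> derived from \<open>\<delta>\<close>, and go back along \<open>v\<close>. It is the same word for
every vertex \<open>y\<close> at which \<open>\<delta>\<close> occurs.
\<close>

lemma shortcut:
  assumes "occurs_before \<delta> u y" "yields P \<delta> (u @ \<gamma> @ v)" "yields P \<delta> \<alpha>"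
    and "u \<in> lists A" "\<gamma> \<in> lists A" "v \<in> lists A"
  shows "\<alpha> \<in> lists A" "run y \<gamma> = run y (inverse_word \<iota> u @ \<alpha> @ inverse_word \<iota> v)"
proof -
  obtain s t where s: "s \<in> lists A" "(derives1 P)\<^sup>*\<^sup>* [Inl S] (map Inr s @ \<delta> @ map Inr t)"
    "run x0 (s @ u) = y" using assms(1) unfolding occurs_before_def by blast
  show \<alpha>: "\<alpha> \<in> lists A" using context_substitution(1)[OF s(2) assms(3,3)] .
  have xs: "run x0 s \<in> V" using run_closed[OF base_point s(1)] .
  have y: "y \<in> V" using s assms(4) run_closed[OF xs] by auto
  have "run x0 (s @ u @ \<gamma> @ v) = run x0 (s @ \<alpha>)"
    by (rule context_substitution(2)[OF s(2) assms(2,3)])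
  then have "run (run y \<gamma>) v = run (run x0 s) \<alpha>" using s(3) by simp
  moreover have "run x0 s = run y (inverse_word \<iota> u)"
    using s(3) run_inverse[OF xs assms(4)] by auto
  ultimately show "run y \<gamma> = run y (inverse_word \<iota> u @ \<alpha> @ inverse_word \<iota> v)"
    using run_inverse[OF run_closed[OF y assms(5)] assms(6)] by simp
qed

text \<open>
The bottleneck property. Complete \<open>\<gamma>\<close> by geodesics from and to the base point, and cut the
derivation of this circuit inside \<open>\<gamma>\<close>, at the vertex \<open>b\<close>. Replacing one half of the production
by a word of length at most \<open>K\<close> connects \<open>b\<close> with the point on the geodesic where the span of
the production starts (or ends). Since \<open>b\<close> is at least as deep as \<open>y\<close>, this point is at most \<open>K\<close>
less deep than \<open>y\<close>, and on a geodesic depth differences are distances.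
\<close>

lemma level_path_decomposition:
  assumes bound: "yield_bound P K"
    and y: "y \<in> V" and \<gamma>: "\<gamma> \<in> stay y" "depth (run y \<gamma>) = depth y" "length \<gamma> \<ge> 2"
  obtains N \<delta> u v where "(N, \<delta>) \<in> P" "u \<in> lists A" "v \<in> lists A" "length u \<le> K" "length v \<le> K"
    "occurs_before \<delta> u y" "yields P \<delta> (u @ \<gamma> @ v)"
proof -
  have \<gamma>A: "\<gamma> \<in> lists A" using \<gamma>(1) unfolding stay_def by blast
  obtain p where p: "p \<in> lists A" "length p = depth y" "run x0 p = y"
    using geodesic_exists[OF y] .
  obtain q where q: "q \<in> lists A" "length q = depth y" "run x0 q = run y \<gamma>"
    using geodesic_exists[OF run_closed[OF y \<gamma>A]] \<gamma>(2) by metis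
  have circuit: "p @ \<gamma> @ inverse_word \<iota> q \<in> grammar_language P S"
    unfolding circuit_iff using p q \<gamma>A inv_lists[OF q(1)] run_inverse[OF base_point q(1)] by simp
  obtain N \<delta>1 \<delta>2 \<gamma>1 \<gamma>2 s u v t where c: "(N, \<delta>1 @ \<delta>2) \<in> P" "\<gamma> = \<gamma>1 @ \<gamma>2" "p = s @ u"
    "inverse_word \<iota> q = v @ t"
    "(derives1 P)\<^sup>*\<^sup>* [Inl S] (map Inr s @ (\<delta>1 @ \<delta>2) @ map Inr t)"
    "yields P \<delta>1 (u @ \<gamma>1)" "yields P \<delta>2 (\<gamma>2 @ v)"
    by (rule grammar_language_cut[OF circuit \<gamma>(3)])
  have A: "s \<in> lists A" "u \<in> lists A" "v \<in> lists A" "t \<in> lists A" "\<gamma>1 \<in> lists A" "\<gamma>2 \<in> lists A"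
    using p(1) c(2,3) \<gamma>A inv_lists[OF q(1)] unfolding c(4) by auto
  \<comment> \<open>The vertex on \<open>\<gamma>\<close> at which the production is cut.\<close>
  define b where "b = run y \<gamma>1"
  have b: "b \<in> V" "depth y \<le> depth b"
    using \<gamma>(1) c(2) run_closed[OF y A(5)] unfolding stay_def b_def by auto
  have b': "b = run x0 (s @ u @ \<gamma>1)" using p(3) c(3) unfolding b_def by simp
  obtain w1 where w1: "yields P \<delta>1 w1" "length w1 \<le> K" using yield_boundE[OF bound c(1) _ c(6)] by blast
  obtain w2 where w2: "yields P \<delta>2 w2" "length w2 \<le> K" using yield_boundE[OF bound c(1) _ c(7)] by blast
  have whole: "yields P (\<delta>1 @ \<delta>2) (u @ \<gamma> @ v)"
    using yields_append[OF c(6,7)] c(2) by simp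
  have y1: "yields P (\<delta>1 @ \<delta>2) (w1 @ \<gamma>2 @ v)" using yields_append[OF w1(1) c(7)] .
  have y2: "yields P (\<delta>1 @ \<delta>2) (u @ \<gamma>1 @ w2)" using yields_append[OF c(6) w2(1)] by simp
  have w1A: "w1 \<in> lists A" using context_substitution(1)[OF c(5) y1 y1] by simp
  have w2A: "w2 \<in> lists A" using context_substitution(1)[OF c(5) y2 y2] by simp
  \<comment> \<open>With \<open>w1\<close> in place of \<open>u @ \<gamma>1\<close>, the vertex \<open>b\<close> is within \<open>K\<close> of the endpoint of \<open>s\<close>.\<close>
  have "run (run x0 (s @ u @ \<gamma>1)) (\<gamma>2 @ v) = run (run x0 (s @ w1)) (\<gamma>2 @ v)"
    using context_substitution(2)[OF c(5) whole y1] c(2) by simp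
  then have "b = run x0 (s @ w1)"
    unfolding b' by (rule run_inj) (use A w1A in \<open>simp_all add: run_closed base_point del: in_lists_conv_set\<close>)
  then have "depth y \<le> length s + K" using b depth_le[of "s @ w1"] A w1A w1(2) by simp
  then have u: "length u \<le> K" using p(2) c(3) by simp
  \<comment> \<open>Symmetrically, with \<open>w2\<close> in place of \<open>\<gamma>2 @ v\<close>, it is within \<open>K\<close> of the starting point of \<open>t\<close>.\<close>
  have "run b w2 = run x0 (inverse_word \<iota> t)"
    using context_substitution(3)[OF c(5) y2 y2] unfolding b' by simp
  then have "b = run x0 (inverse_word \<iota> t @ inverse_word \<iota> w2)"
    using run_inverse[OF b(1) w2A] by simp
  then have "depth y \<le> length t + K"
    using b depth_le[of "inverse_word \<iota> t @ inverse_word \<iota> w2"] inv_lists[OF A(4)] inv_lists[OF w2A] w2(2)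
    by simp
  moreover have "length v + length t = depth y"
    using arg_cong[OF c(4), of length] q(2) by simp
  ultimately have v: "length v \<le> K" by simp
  have "occurs_before (\<delta>1 @ \<delta>2) u y"
    unfolding occurs_before_def using A(1) c(3,5) p(3) by blast
  then show thesis using that c(1) A u v whole by blast
qed

text \<open>
What has to be known about the surroundings of \<open>y\<close> in order to determine \<open>stay y\<close>: the
right-hand sides that occur nearby, and the short words that lead closer to the base point. The
length \<open>3 * K + 2\<close> has room for a shortcut, which consists of three parts of length at most \<open>K\<close>,
or for a single letter if \<open>K = 0\<close>, followed by one more letter.
\<close>

definition local_data :: "nat \<Rightarrow> 'b \<Rightarrow> ((nat + 'a) list \<times> 'a list) set \<times> 'a list set" where
  "local_data K y =
     ({(\<delta>, u). \<delta> \<in> snd ` P \<and> u \<in> lists A \<and> length u \<le> K \<and> occurs_before \<delta> u y},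
      {w \<in> lists A. length w \<le> 3 * K + 2 \<and> depth (run y w) < depth y})"

text \<open>
Consider the first letter \<open>a\<close> at which the walk from \<open>z\<close> becomes less deep than \<open>z\<close>. The word
\<open>\<gamma>\<close> before it ends at the depth of \<open>z\<close>, so its endpoint is also reached by a bounded word \<open>w\<close>,
and by the equality of the local data \<open>w\<close> can replace \<open>\<gamma>\<close> also at \<open>y\<close>. As \<open>w @ [a]\<close> is short, the
data also say that it leads out at \<open>y\<close>.
\<close>

lemma stay_subset:
  assumes bound: "yield_bound P K"
    and V: "y \<in> V" "z \<in> V" and data: "local_data K y = local_data K z" and w: "w \<in> stay y"
  shows "w \<in> stay z"
  using w
proof (induction w rule: rev_induct)
  case Nil
  then show ?case unfolding stay_def by simp
next
  case (snoc a \<gamma>)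
  have \<gamma>y: "\<gamma> \<in> stay y" using snoc.prems by (rule stay_prefix)
  then have \<gamma>: "\<gamma> \<in> stay z" by (rule snoc.IH)
  have A: "\<gamma> \<in> lists A" "a \<in> A" using snoc.prems unfolding stay_def by auto
  have zV: "run z \<gamma> \<in> V" using run_closed[OF V(2) A(1)] .
  have last: "depth z \<le> depth (run z (\<gamma> @ [a]))"
  proof (rule ccontr)
    assume exit: "\<not> depth z \<le> depth (run z (\<gamma> @ [a]))"
    have "depth z \<le> depth (run z \<gamma>)" using \<gamma> unfolding stay_def by auto
    then have level: "depth (run z \<gamma>) = depth z"
      using exit depth_step(2)[OF zV A(2)] by simp
    \<comment> \<open>A bounded replacement for \<open>\<gamma>\<close> that works at both vertices.\<close>
    have "\<exists>w\<in>lists A. length w \<le> 3 * K + 1 \<and> run y \<gamma> = run y w \<and> run z \<gamma> = run z w"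
    proof (cases "length \<gamma> \<ge> 2")
      case False
      then show ?thesis using A by (intro bexI[of _ \<gamma>]) auto
    next
      case True
      obtain N \<delta> u v where d: "(N, \<delta>) \<in> P" "u \<in> lists A" "v \<in> lists A" "length u \<le> K"
        "length v \<le> K" "occurs_before \<delta> u z" "yields P \<delta> (u @ \<gamma> @ v)"
        using level_path_decomposition[OF bound V(2) \<gamma> level True] by blast
      have "(\<delta>, u) \<in> fst (local_data K z)"
        using d unfolding local_data_def by force
      then have "(\<delta>, u) \<in> fst (local_data K y)" using data by simp
      then have oy: "occurs_before \<delta> u y" unfolding local_data_def by simp
      obtain \<alpha> where \<alpha>: "yields P \<delta> \<alpha>" "length \<alpha> \<le> K"
        using yield_boundE[OF bound, of N \<delta> "[]" \<delta>] d(1,7) by auto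
      let ?w = "inverse_word \<iota> u @ \<alpha> @ inverse_word \<iota> v"
      have "run y \<gamma> = run y ?w" "run z \<gamma> = run z ?w" "\<alpha> \<in> lists A"
        using shortcut[OF oy d(7) \<alpha>(1) d(2) A(1) d(3)] shortcut[OF d(6,7) \<alpha>(1) d(2) A(1) d(3)]
        by auto
      then show ?thesis using d \<alpha>(2) inv_lists by (intro bexI[of _ ?w]) auto
    qed
    then obtain w where w: "w \<in> lists A" "length w \<le> 3 * K + 1" "run y \<gamma> = run y w" "run z \<gamma> = run z w"
      by blast
    then have "w @ [a] \<in> snd (local_data K z)"
      using exit A(2) unfolding local_data_def by simp
    then have "w @ [a] \<in> snd (local_data K y)" using data by simp
    then have "depth (run y (\<gamma> @ [a])) < depth y"
      using w(3) unfolding local_data_def by simp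
    moreover have "depth y \<le> depth (run y (\<gamma> @ [a]))" using snoc.prems by (rule stay_depth)
    ultimately show False by simp
  qed
  show ?case
    unfolding stay_def
  proof (intro CollectI conjI allI impI)
    show "\<gamma> @ [a] \<in> lists A" using A by simp
    fix s t assume "\<gamma> @ [a] = s @ t"
    then consider "s = \<gamma> @ [a]" | r where "\<gamma> = s @ r"
      by (metis append_Nil2 append_butlast_last_id butlast_append butlast_snoc)
    then show "depth z \<le> depth (run z s)"
      using last \<gamma> unfolding stay_def by cases auto
  qed
qed

lemma finite_A: "finite A"
  using alphabet unfolding involutive_alphabet_def by blast

lemma finite_short_words: "finite {w \<in> lists A. length w \<le> n}"
proof -
  have "{w \<in> lists A. length w \<le> n} = {w. set w \<subseteq> A \<and> length w \<le> n}"
    by (auto simp: in_lists_conv_set)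
  then show ?thesis using finite_lists_length_le[OF finite_A] by simp
qed

lemma finite_stay: "finite (stay ` V)"
proof -
  obtain K where bound: "yield_bound P K" using yield_bound_exists[OF finite_P] by blast
  have "local_data K ` V \<subseteq> Pow (snd ` P \<times> {w \<in> lists A. length w \<le> K}) \<times>
      Pow {w \<in> lists A. length w \<le> 3 * K + 2}"
    unfolding local_data_def by auto
  then have "finite (local_data K ` V)"
    by (rule finite_subset) (intro finite_cartesian_product finite_Pow_iff[THEN iffD2]
        finite_imageI finite_P finite_short_words)
  then show ?thesis
      proof (rule finite_image_factor)
    fix y z assume "y \<in> V" "z \<in> V" "local_data K y = local_data K z"
    then show "stay y = stay z"
      by (intro equalityI subsetI) (auto intro: stay_subset[OF bound])
  qed
qed

text \<open>
Two vertices on a long geodesic have the same \<open>stay\<close> set; the word between them has an infinite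
orbit.
\<close>

theorem finite_if_pointwise_torsion:
  assumes torsion: "\<And>w v. w \<in> lists A \<Longrightarrow> v \<in> V \<Longrightarrow> \<exists>m>0. run v (concat (replicate m w)) = v"
  shows "finite V"
proof (rule ccontr)
  assume inf: "infinite V"
  define c where "c = card (stay ` V)"
  have "\<not> V \<subseteq> run x0 ` {w \<in> lists A. length w \<le> c}"
    using inf finite_short_words finite_subset by blast
  then obtain v where v: "v \<in> V" "v \<notin> run x0 ` {w \<in> lists A. length w \<le> c}" by blast
  obtain w where w: "w \<in> lists A" "length w = depth v" "run x0 w = v"
    using geodesic_exists[OF v(1)] .
  have long: "c < length w" using v(2) w by force
  define x where "x i = run x0 (take i w)" for i
  have take_A: "take i w \<in> lists A" "drop i w \<in> lists A" for i
    using w(1) by (auto simp: in_lists_conv_set dest: in_set_takeD in_set_dropD)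
  have xV: "x i \<in> V" for i unfolding x_def by (rule run_closed[OF base_point take_A(1)])
  have depth_x: "depth (x i) = i" if "i \<le> length w" for i
    using geodesic_prefix[of "take i w" "drop i w"] w that unfolding x_def by simp
  have "\<not> inj_on (stay \<circ> x) {..c}"
  proof
    assume "inj_on (stay \<circ> x) {..c}"
    then have "card {..c} \<le> card (stay ` V)"
      by (rule card_inj_on_le) (use xV finite_stay in auto)
    then show False unfolding c_def by simp
  qed
  then obtain i' j' where "i' \<le> c" "j' \<le> c" "i' \<noteq> j'" "stay (x i') = stay (x j')"
    unfolding inj_on_def by auto
  then obtain i j where ij: "i < j" "j \<le> c" "stay (x i) = stay (x j)"
    by (cases "i' < j'") (auto intro: that[of i' j'] that[of j' i'])
  define q where "q = drop i (take j w)"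
  have jw: "j \<le> length w" using ij long by simp
  have split: "take (i + k) w = take i w @ take k q" if "k \<le> j - i" for k
    using that unfolding q_def by (simp add: take_add drop_take)
  have qA: "q \<in> lists A" using take_A(1)[of j] unfolding q_def
    by (auto simp: in_lists_conv_set dest: in_set_dropD)
  have len_q: "length q = j - i" using jw unfolding q_def by simp
  have run_q: "run (x i) q = x j"
    using split[of "j - i"] ij(1) len_q unfolding x_def by simp
  have q_stay: "q \<in> stay (x i)"
    unfolding stay_def
  proof (intro CollectI conjI allI impI qA)
    fix s t assume st: "q = s @ t"
    then have "run (x i) s = x (i + length s)"
      using split[of "length s"] len_q unfolding x_def by simp
    moreover have "i + length s \<le> length w" using st len_q ij jw by auto
    ultimately show "depth (x i) \<le> depth (run (x i) s)"
      using depth_x[of "i + length s"] depth_x[of i] ij jw by simp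
  qed
  have powers: "concat (replicate k q) \<in> stay (x i)" for k
  proof (induction k)
    case 0
    show ?case unfolding stay_def by simp
  next
    case (Suc k)
    then show ?case using stay_append[OF q_stay] run_q ij(3) by simp
  qed
  obtain m where m: "m > 0" "run (x i) (concat (replicate m q)) = x i"
    using torsion[OF qA xV] by blast
  then obtain k where k: "m = Suc k" by (cases m) auto
  have "depth (x j) \<le> depth (run (x j) (concat (replicate k q)))"
    using stay_depth[of "concat (replicate k q)" "x j"] powers[of k] unfolding ij(3) .
  also have "run (x j) (concat (replicate k q)) = x i" using m(2) k run_q by simp
  finally show False using depth_x[of i] depth_x[of j] ij jw by simp
qed

end


section \<open>Complete graphs as letter actions\<close>

definition arc_at :: "('v, 'e, 'a) labelled_graph \<Rightarrow> 'v \<Rightarrow> 'a \<Rightarrow> 'e" where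
  "arc_at \<Gamma> v a = (THE e. e \<in> arcs (base \<Gamma>) \<and> tail (base \<Gamma>) e = v \<and> label \<Gamma> e = a)"

definition graph_step :: "('v, 'e, 'a) labelled_graph \<Rightarrow> 'v \<Rightarrow> 'a \<Rightarrow> 'v" where
  "graph_step \<Gamma> v a = head (base \<Gamma>) (arc_at \<Gamma> v a)"

locale complete_A_graph =
  fixes A :: "'a set" and \<iota> :: "'a \<Rightarrow> 'a" and \<Gamma> :: "('v, 'e, 'a) labelled_graph"
  assumes alph: "involutive_alphabet A \<iota>"
    and graph: "A_graph A \<iota> \<Gamma>"
    and complete: "complete_graph A \<Gamma>"
begin

sublocale wf_digraph "base \<Gamma>"
  using graph unfolding A_graph_def by blast

lemma arc_facts:
  assumes "e \<in> arcs (base \<Gamma>)"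
  shows "label \<Gamma> e \<in> A" "arc_inv \<Gamma> e \<in> arcs (base \<Gamma>)"
    "tail (base \<Gamma>) (arc_inv \<Gamma> e) = head (base \<Gamma>) e"
    "head (base \<Gamma>) (arc_inv \<Gamma> e) = tail (base \<Gamma>) e"
    "label \<Gamma> (arc_inv \<Gamma> e) = \<iota> (label \<Gamma> e)"
  using graph assms unfolding A_graph_def by blast+

lemma deterministic:
  "\<lbrakk>e \<in> arcs (base \<Gamma>); f \<in> arcs (base \<Gamma>); tail (base \<Gamma>) e = tail (base \<Gamma>) f; label \<Gamma> e = label \<Gamma> f\<rbrakk>
    \<Longrightarrow> e = f"
  using graph unfolding A_graph_def by blast

lemma arc_at:
  assumes "v \<in> verts (base \<Gamma>)" "a \<in> A"
  shows "arc_at \<Gamma> v a \<in> arcs (base \<Gamma>)" "tail (base \<Gamma>) (arc_at \<Gamma> v a) = v" "label \<Gamma> (arc_at \<Gamma> v a) = a"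
proof -
  have "\<exists>!e. e \<in> arcs (base \<Gamma>) \<and> tail (base \<Gamma>) e = v \<and> label \<Gamma> e = a"
    using complete assms deterministic unfolding complete_graph_def by metis
  from theI'[OF this] show "arc_at \<Gamma> v a \<in> arcs (base \<Gamma>)" "tail (base \<Gamma>) (arc_at \<Gamma> v a) = v"
    "label \<Gamma> (arc_at \<Gamma> v a) = a" unfolding arc_at_def by blast+
qed

lemma arc_at_eq: "e \<in> arcs (base \<Gamma>) \<Longrightarrow> arc_at \<Gamma> (tail (base \<Gamma>) e) (label \<Gamma> e) = e"
  by (intro deterministic arc_at) (auto simp: arc_at arc_facts)

lemma graph_step_arc: "e \<in> arcs (base \<Gamma>) \<Longrightarrow> graph_step \<Gamma> (tail (base \<Gamma>) e) (label \<Gamma> e) = head (base \<Gamma>) e"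
  unfolding graph_step_def by (simp add: arc_at_eq)

sublocale letter_action A \<iota> "verts (base \<Gamma>)" "graph_step \<Gamma>"
proof
  fix v a assume va: "v \<in> verts (base \<Gamma>)" "a \<in> A"
  note e = arc_at[OF va]
  show "graph_step \<Gamma> v a \<in> verts (base \<Gamma>)"
    unfolding graph_step_def using e(1) by simp
  have "graph_step \<Gamma> (head (base \<Gamma>) (arc_at \<Gamma> v a)) (\<iota> a) = v"
    using graph_step_arc[OF arc_facts(2)[OF e(1)]] arc_facts[OF e(1)] e(2,3) by simp
  then show "graph_step \<Gamma> (graph_step \<Gamma> v a) (\<iota> a) = v" unfolding graph_step_def .
qed (rule alph)

lemma awalk_run:
  "awalk v p u \<Longrightarrow> map (label \<Gamma>) p \<in> lists A \<and> run v (map (label \<Gamma>) p) = u"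
proof (induction p arbitrary: v)
  case (Cons e p)
  then have e: "e \<in> arcs (base \<Gamma>)" "v = tail (base \<Gamma>) e" "awalk (head (base \<Gamma>) e) p u"
    by (auto simp: awalk_Cons_iff)
  then show ?case using Cons.IH[OF e(3)] graph_step_arc[OF e(1)] arc_facts(1)[OF e(1)] by simp
qed (simp add: awalk_Nil_iff)

lemma run_awalk:
  "v \<in> verts (base \<Gamma>) \<Longrightarrow> w \<in> lists A \<Longrightarrow> \<exists>p. awalk v p (run v w) \<and> map (label \<Gamma>) p = w"
proof (induction w arbitrary: v)
  case Nil
  then show ?case by (auto simp: awalk_Nil_iff)
next
  case (Cons a w)
  then have a: "a \<in> A" "w \<in> lists A" by auto
  note e = arc_at[OF Cons.prems(1) a(1)]
  obtain p where p: "awalk (graph_step \<Gamma> v a) p (run (graph_step \<Gamma> v a) w)" "map (label \<Gamma>) p = w"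
    using Cons.IH[OF step_closed[OF Cons.prems(1) a(1)] a(2)] by blast
  then show ?case
    using e by (intro exI[of _ "arc_at \<Gamma> v a # p"])
      (auto simp: awalk_Cons_iff graph_step_def[of \<Gamma> v a, symmetric])
qed

lemma circuit_language_eq:
  assumes "x \<in> verts (base \<Gamma>)"
  shows "circuit_language \<Gamma> x = {w \<in> lists A. run x w = x}"
proof -
  have "w \<in> circuit_language \<Gamma> x \<longleftrightarrow> w \<in> lists A \<and> run x w = x" for w
  proof
    assume "w \<in> circuit_language \<Gamma> x"
    then show "w \<in> lists A \<and> run x w = x" using awalk_run unfolding circuit_language_def by blast
  next
    assume "w \<in> lists A \<and> run x w = x"
    then show "w \<in> circuit_language \<Gamma> x"
      using run_awalk[OF assms, of w] unfolding circuit_language_def by auto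
  qed
  then show ?thesis by blast
qed

text \<open>
Connectedness is defined by the underlying undirected graph, but every arc has an inverse.
\<close>

lemma all_reachable:
  assumes "x \<in> verts (base \<Gamma>)" "v \<in> verts (base \<Gamma>)"
  shows "\<exists>w\<in>lists A. run x w = v"
proof -
  have "symmetric (base \<Gamma>)"
    unfolding symmetric_conv using arc_facts by metis
  moreover have "x \<rightarrow>\<^sup>*\<^bsub>mk_symmetric (base \<Gamma>)\<^esub> v"
    using graph assms unfolding A_graph_def connected_def strongly_connected_def by simp
  ultimately have "x \<rightarrow>\<^sup>*\<^bsub>base \<Gamma>\<^esub> v"
    by (simp add: reachable_mk_symmetric_eq)
  then obtain p where "awalk x p v" by (auto simp: reachable_awalk)
  then show ?thesis using awalk_run by blast
qed

lemma finite_verts_if_pointwise_torsion: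
  assumes "context_free_graph \<Gamma>"
    and "\<And>w v. w \<in> lists A \<Longrightarrow> v \<in> verts (base \<Gamma>) \<Longrightarrow> \<exists>m>0. run v (concat (replicate m w)) = v"
  shows "finite (verts (base \<Gamma>))"
proof -
  obtain x P S where x: "x \<in> verts (base \<Gamma>)" "finite P" "circuit_language \<Gamma> x = grammar_language P S"
    using assms(1) unfolding context_free_graph_def context_free_language_def by blast
  interpret context_free_action A \<iota> "verts (base \<Gamma>)" "graph_step \<Gamma>" x P S
    by unfold_locales (use x all_reachable circuit_language_eq in auto)
  show ?thesis using assms(2) by (rule finite_if_pointwise_torsion)
qed

end


section \<open>Free reduction\<close>

lemma reduce_append: "reduce \<iota> (u @ v) = foldr (cons_reduce \<iota>) u (reduce \<iota> v)"
  unfolding reduce_def by simp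

lemma reduced_ConsD: "reduced \<iota> (a # w) \<Longrightarrow> reduced \<iota> w"
  unfolding reduced_def by (metis append_Cons)

lemma reduced_no_cancel: "reduced \<iota> (a # b # w) \<Longrightarrow> b \<noteq> \<iota> a"
  unfolding reduced_def by (metis append_Cons append_Nil)

lemma reduced_Cons:
  assumes "reduced \<iota> w" "w = [] \<or> hd w \<noteq> \<iota> a"
  shows "reduced \<iota> (a # w)"
proof -
  have False if eq: "a # w = u @ [c, \<iota> c] @ v" for u c v
  proof (cases u)
    case Nil
    then show False using eq assms(2) by auto
  next
    case (Cons b u')
    then show False using eq assms(1) unfolding reduced_def by auto
  qed
  then show ?thesis unfolding reduced_def by blast
qed

lemma reduced_cons_reduce: "reduced \<iota> w \<Longrightarrow> reduced \<iota> (cons_reduce \<iota> a w)"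
  by (cases w) (auto intro: reduced_Cons dest: reduced_ConsD simp: reduced_def Cons_eq_append_conv)

lemma reduced_foldr: "reduced \<iota> v \<Longrightarrow> reduced \<iota> (foldr (cons_reduce \<iota>) u v)"
  by (induction u) (auto intro: reduced_cons_reduce)

lemma reduced_reduce: "reduced \<iota> (reduce \<iota> w)"
  unfolding reduce_def by (rule reduced_foldr) (simp add: reduced_def)

lemma reduce_lists: "w \<in> lists A \<Longrightarrow> reduce \<iota> w \<in> lists A"
proof (induction w)
  case (Cons a w)
  then have "reduce \<iota> w \<in> lists A" "a \<in> A" by auto
  moreover have "reduce \<iota> (a # w) = cons_reduce \<iota> a (reduce \<iota> w)" unfolding reduce_def by simp
  ultimately show ?case by (cases "reduce \<iota> w") auto
qed (simp add: reduce_def)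

lemma reduce_reduced: "reduced \<iota> w \<Longrightarrow> reduce \<iota> w = w"
proof (induction w)
  case (Cons a w)
  have "reduce \<iota> (a # w) = cons_reduce \<iota> a w"
    using Cons.IH[OF reduced_ConsD[OF Cons.prems]] unfolding reduce_def by simp
  then show ?case using Cons.prems by (cases w) (auto dest: reduced_no_cancel)
qed (simp add: reduce_def)

text \<open>
Left multiplication by a letter permutes the reduced words. This is what makes \<open>reduce\<close> a normal
form for free reduction.
\<close>

lemma cons_reduce_cancel:
  assumes "involutive_alphabet A \<iota>" "a \<in> A" "reduced \<iota> w"
  shows "cons_reduce \<iota> a (cons_reduce \<iota> (\<iota> a) w) = w"
proof (cases w)
  case (Cons b w')
  have i: "\<iota> (\<iota> a) = a" using assms(1,2) unfolding involutive_alphabet_def by blast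
  show ?thesis
  proof (cases "b = a")
    case True
    then have "cons_reduce \<iota> (\<iota> a) w = w'" using Cons i by simp
    moreover have "cons_reduce \<iota> a w' = w"
      using assms(3) Cons True by (cases w') (auto dest: reduced_no_cancel)
    ultimately show ?thesis by simp
  qed (use Cons i in simp)
qed simp

lemma foldr_cons_reduce:
  assumes "involutive_alphabet A \<iota>" "a \<in> A" "r \<in> lists A" "reduced \<iota> z"
  shows "foldr (cons_reduce \<iota>) (cons_reduce \<iota> a r) z = cons_reduce \<iota> a (foldr (cons_reduce \<iota>) r z)"
  using cons_reduce_cancel[OF assms(1,2) reduced_foldr[OF assms(4)]] by (cases r) auto

lemma reduce_reduce_append:
  assumes "involutive_alphabet A \<iota>" "u \<in> lists A"
  shows "reduce \<iota> (reduce \<iota> u @ v) = reduce \<iota> (u @ v)"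
  using assms(2)
proof (induction u rule: list.induct)
  case (Cons a u)
  then have a: "a \<in> A" and u: "u \<in> lists A" by auto
  have "reduce \<iota> (reduce \<iota> (a # u) @ v) =
      foldr (cons_reduce \<iota>) (cons_reduce \<iota> a (reduce \<iota> u)) (reduce \<iota> v)"
    unfolding reduce_append by (simp add: reduce_def)
  also have "\<dots> = cons_reduce \<iota> a (foldr (cons_reduce \<iota>) (reduce \<iota> u) (reduce \<iota> v))"
    by (rule foldr_cons_reduce[OF assms(1) a reduce_lists[OF u] reduced_reduce])
  also have "\<dots> = cons_reduce \<iota> a (reduce \<iota> (u @ v))"
    using Cons unfolding reduce_append[symmetric] by simp
  finally show ?case unfolding reduce_def by simp
qed (simp add: reduce_def)

lemma reduce_cancel:
  assumes "involutive_alphabet A \<iota>" "w \<in> lists A"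
  shows "reduce \<iota> (u @ inverse_word \<iota> w @ w @ v) = reduce \<iota> (u @ v)"
proof -
  have "foldr (cons_reduce \<iota>) (inverse_word \<iota> w @ w) z = z" if "reduced \<iota> z" for z
    using assms(2) that
  proof (induction w arbitrary: z rule: list.induct)
    case (Cons a w)
    have "a \<in> A" using Cons.prems(1) by simp
    then have a: "\<iota> a \<in> A" "\<iota> (\<iota> a) = a" using assms(1) unfolding involutive_alphabet_def by auto
    have "cons_reduce \<iota> (\<iota> a) (cons_reduce \<iota> a (foldr (cons_reduce \<iota>) w z)) = foldr (cons_reduce \<iota>) w z"
      using cons_reduce_cancel[OF assms(1) a(1) reduced_foldr[OF Cons.prems(2)]] a(2) by simp
    then show ?case using Cons by simp
  qed simp
  from this[OF reduced_reduce] show ?thesis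
    unfolding reduce_append foldr_append[symmetric] append_assoc[symmetric] by (simp add: reduce_append)
qed

context letter_action begin

lemma run_cons_reduce:
  assumes "v \<in> V" "a \<in> A" "w \<in> lists A"
  shows "run v (cons_reduce \<iota> a w) = run v (a # w)"
  using assms step_inverse by (cases w) auto

lemma run_reduce: "v \<in> V \<Longrightarrow> w \<in> lists A \<Longrightarrow> run v (reduce \<iota> w) = run v w"
proof (induction w arbitrary: v)
  case (Cons a w)
  then have a: "a \<in> A" "w \<in> lists A" by auto
  have "run v (reduce \<iota> (a # w)) = run v (a # reduce \<iota> w)"
    using run_cons_reduce[OF Cons.prems(1) a(1) reduce_lists[OF a(2)]] unfolding reduce_def by simp
  then show ?case using Cons.IH[OF step_closed[OF Cons.prems(1) a(1)] a(2)] by simp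
qed (simp add: reduce_def)

end

section \<open>The transition group as a permutation group\<close>

locale complete_A_graphs =
  fixes A :: "'a set" and \<iota> :: "'a \<Rightarrow> 'a" and \<Gamma>s :: "('v, 'e, 'a) labelled_graph list"
  assumes alph: "involutive_alphabet A \<iota>"
    and graphs: "\<Gamma> \<in> set \<Gamma>s \<Longrightarrow> A_graph A \<iota> \<Gamma> \<and> complete_graph A \<Gamma>"
begin

text \<open>
The disjoint union of the vertex sets. A graph that is listed more than once contributes only one
copy, on which the letters act in the same way as on any other.
\<close>

definition points :: "(('v, 'e, 'a) labelled_graph \<times> 'v) set" where
  "points = (SIGMA \<Gamma> : set \<Gamma>s. verts (base \<Gamma>))"

definition pstep :: "('v, 'e, 'a) labelled_graph \<times> 'v \<Rightarrow> 'a \<Rightarrow> ('v, 'e, 'a) labelled_graph \<times> 'v" where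
  "pstep x a = (fst x, graph_step (fst x) (snd x) a)"

lemma complete_A_graph: "\<Gamma> \<in> set \<Gamma>s \<Longrightarrow> complete_A_graph A \<iota> \<Gamma>"
  using alph graphs by (simp add: complete_A_graph_def)

sublocale letter_action A \<iota> points pstep
proof
  fix x a assume x: "x \<in> points" and a: "a \<in> A"
  then interpret complete_A_graph A \<iota> "fst x"
    by (intro complete_A_graph) (auto simp: points_def)
  have "snd x \<in> verts (base (fst x))" using x by (auto simp: points_def)
  then show "pstep x a \<in> points" "pstep (pstep x a) (\<iota> a) = x"
    using x a step_closed step_inverse by (auto simp: points_def pstep_def)
qed (rule alph)

lemma run_pair: "run (\<Gamma>, v) w = (\<Gamma>, foldl (graph_step \<Gamma>) v w)"
  by (induction w arbitrary: v) (auto simp: pstep_def)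

lemma trivial_words_eq: "trivial_words A \<Gamma>s = {w \<in> lists A. \<forall>x\<in>points. run x w = x}"
proof -
  have "p \<in> verts (base \<Gamma>) \<Longrightarrow> \<Gamma> \<in> set \<Gamma>s \<Longrightarrow> w \<in> circuit_language \<Gamma> p \<longleftrightarrow> w \<in> lists A \<and> run (\<Gamma>, p) w = (\<Gamma>, p)"
    for \<Gamma> p w
    using complete_A_graph.circuit_language_eq[OF complete_A_graph] by (auto simp: run_pair)
  then show ?thesis unfolding trivial_words_def points_def by auto
qed

abbreviation "N \<equiv> reduce \<iota> ` trivial_words A \<Gamma>s"

lemma N_iff: "w \<in> N \<longleftrightarrow> w \<in> lists A \<and> reduced \<iota> w \<and> (\<forall>x\<in>points. run x w = x)"
proof
  assume "w \<in> N"
  then obtain u where u: "w = reduce \<iota> u" "u \<in> lists A" "\<forall>x\<in>points. run x u = x"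
    unfolding trivial_words_eq by blast
  then show "w \<in> lists A \<and> reduced \<iota> w \<and> (\<forall>x\<in>points. run x w = x)"
    using reduce_lists[OF u(2)] reduced_reduce run_reduce[OF _ u(2)] by metis
next
  assume "w \<in> lists A \<and> reduced \<iota> w \<and> (\<forall>x\<in>points. run x w = x)"
  then show "w \<in> N" unfolding trivial_words_eq
    by (intro image_eqI[of _ _ w]) (auto simp: reduce_reduced)
qed

definition coset :: "'a list \<Rightarrow> 'a list set" where
  "coset w = (\<lambda>h. reduce \<iota> (h @ w)) ` N"

lemma carrier_transition_group:
  "carrier (transition_group A \<iota> \<Gamma>s) = coset ` {w \<in> lists A. reduced \<iota> w}"
  unfolding transition_group_def FactGroup_def RCOSETS_def r_coset_def free_group_def coset_def
  by auto

lemma mult_transition_group: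
  "X \<otimes>\<^bsub>transition_group A \<iota> \<Gamma>s\<^esub> Y = {reduce \<iota> (u @ v) |u v. u \<in> X \<and> v \<in> Y}"
  unfolding transition_group_def FactGroup_def set_mult_def free_group_def by auto

lemma coset_member:
  assumes "w \<in> lists A" "reduced \<iota> w"
  shows "w \<in> coset w"
proof -
  have "[] \<in> N" unfolding N_iff by (simp add: reduced_def)
  moreover have "w = reduce \<iota> ([] @ w)" using reduce_reduced[OF assms(2)] by simp
  ultimately show ?thesis unfolding coset_def by blast
qed

lemma coset_lists:
  assumes "w \<in> lists A" "u \<in> coset w" 
  shows "u \<in> lists A"
proof -
  obtain h where h: "h \<in> N" "u = reduce \<iota> (h @ w)" using assms(2) unfolding coset_def by blast
  then show ?thesis using reduce_lists[of "h @ w" A] assms(1) unfolding N_iff by simp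
qed

lemma coset_run:
  assumes "w \<in> lists A" "u \<in> coset w" "x \<in> points"
  shows "run x u = run x w"
proof -
  obtain h where h: "h \<in> N" "u = reduce \<iota> (h @ w)" using assms(2) unfolding coset_def by blast
  then show ?thesis using run_reduce[OF assms(3), of "h @ w"] assms(1,3) unfolding N_iff by simp
qed

lemma coset_subset:
  assumes "w \<in> lists A" "w' \<in> lists A" "\<And>x. x \<in> points \<Longrightarrow> run x w = run x w'"
  shows "coset w \<subseteq> coset w'"
proof
  fix u assume "u \<in> coset w"
  then obtain h where h: "h \<in> N" "u = reduce \<iota> (h @ w)" unfolding coset_def by blast
  let ?k = "h @ w @ inverse_word \<iota> w'"
  have hA: "h \<in> lists A" "\<And>x. x \<in> points \<Longrightarrow> run x h = x" using h(1) unfolding N_iff by auto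
  have kA: "?k \<in> lists A" using hA(1) assms(1) inv_lists[OF assms(2)] by simp
  have "run x ?k = x" if "x \<in> points" for x
    using hA(2)[OF that] assms(3)[OF that] run_inverse[OF that assms(2)] by simp
  then have "?k \<in> trivial_words A \<Gamma>s" unfolding trivial_words_eq using kA by simp
  moreover have "u = reduce \<iota> (reduce \<iota> ?k @ w')"
    using reduce_reduce_append[OF alph kA] reduce_cancel[OF alph assms(2), of "h @ w" "[]"] h(2)
    by simp
  ultimately show "u \<in> coset w'" unfolding coset_def by blast
qed

text \<open>
Words that induce the same permutation are in the same coset, so the transition group is no larger
than the group of permutations that the letters generate.
\<close>

lemma coset_eqI:
  assumes "w \<in> lists A" "w' \<in> lists A" "\<And>x. x \<in> points \<Longrightarrow> run x w = run x w'"
  shows "coset w = coset w'"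
  using coset_subset[OF assms] coset_subset[OF assms(2,1)] assms(3) by auto

lemma finite_transition_group:
  assumes "finite points"
  shows "finite (carrier (transition_group A \<iota> \<Gamma>s))"
proof -
  \<comment> \<open>Restriction makes these functions members of a finite function space.\<close>
  let ?f = "\<lambda>w. restrict (\<lambda>x. run x w) points"
  have "?f ` {w \<in> lists A. reduced \<iota> w} \<subseteq> points \<rightarrow>\<^sub>E points"
    by (intro image_subsetI) (simp add: PiE_iff run_closed del: in_lists_conv_set)
  then have "finite (?f ` {w \<in> lists A. reduced \<iota> w})"
    using finite_PiE[OF assms, of "\<lambda>_. points"] assms finite_subset by blast
  then show ?thesis
    unfolding carrier_transition_group
  proof (rule finite_image_factor)
    fix w w' assume *: "w \<in> {w \<in> lists A. reduced \<iota> w}" "w' \<in> {w \<in> lists A. reduced \<iota> w}" "?f w = ?f w'"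
    have "run x w = run x w'" if "x \<in> points" for x
      using fun_cong[OF *(3), of x] that by simp
    with * show "coset w = coset w'" by (intro coset_eqI) auto
  qed
qed

text \<open>
The coset \<open>X\<close>, as an element of the transition group, is the permutation induced by the word \<open>w\<close>.
Nonemptiness makes this permutation unique.
\<close>

definition acts_as :: "'a list set \<Rightarrow> 'a list \<Rightarrow> bool" where
  "acts_as X w \<longleftrightarrow> X \<noteq> {} \<and> (\<forall>u\<in>X. u \<in> lists A \<and> (\<forall>x\<in>points. run x u = run x w))"

lemma carrier_acts_as:
  assumes "X \<in> carrier (transition_group A \<iota> \<Gamma>s)"
  shows "\<exists>w\<in>lists A. acts_as X w"
proof -
  obtain w where w: "w \<in> lists A" "reduced \<iota> w" "X = coset w"
    using assms unfolding carrier_transition_group by blast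
  then show ?thesis
    using coset_member coset_lists coset_run unfolding acts_as_def by blast
qed

lemma mult_acts_as:
  assumes "acts_as X u" "acts_as Y v"
  shows "acts_as (X \<otimes>\<^bsub>transition_group A \<iota> \<Gamma>s\<^esub> Y) (u @ v)"
proof -
  have "reduce \<iota> (s @ t) \<in> lists A \<and> (\<forall>x\<in>points. run x (reduce \<iota> (s @ t)) = run x (u @ v))"
    if "s \<in> X" "t \<in> Y" for s t
  proof -
    have st: "s \<in> lists A" "t \<in> lists A" using assms that unfolding acts_as_def by auto
    have "run x (reduce \<iota> (s @ t)) = run x (u @ v)" if x: "x \<in> points" for x
    proof -
      have "run x (reduce \<iota> (s @ t)) = run (run x s) t" using run_reduce[OF x, of "s @ t"] st by simp
      also have "\<dots> = run (run x s) v"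
        using assms(2) \<open>t \<in> Y\<close> run_closed[OF x st(1)] unfolding acts_as_def by blast
      also have "run x s = run x u" using assms(1) \<open>s \<in> X\<close> x unfolding acts_as_def by blast
      finally show ?thesis by simp
    qed
    then show ?thesis using st reduce_lists[of "s @ t"] by simp
  qed
  then show ?thesis using assms unfolding acts_as_def mult_transition_group by blast
qed

lemma acts_as_unique:
  "acts_as X u \<Longrightarrow> acts_as X v \<Longrightarrow> x \<in> points \<Longrightarrow> run x u = run x v"
  unfolding acts_as_def by fastforce

text \<open>
The isomorphism sends products to concatenations. In particular the image of the neutral element
induces an idempotent permutation, hence the identity, and torsion carries over to words.
\<close>

lemma words_torsion:
  fixes G :: "('g, 'm) monoid_scheme"
  assumes G: "torsion_group G" and iso: "G \<cong> transition_group A \<iota> \<Gamma>s" and w: "w \<in> lists A"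
  shows "\<exists>m>0. \<forall>x\<in>points. run x (concat (replicate m w)) = x"
proof -
  let ?T = "transition_group A \<iota> \<Gamma>s"
  interpret G: group G using G unfolding torsion_group_def by blast
  obtain h where h: "h \<in> hom G ?T" "bij_betw h (carrier G) (carrier ?T)"
    using iso unfolding is_iso_def iso_def by blast
  have hc: "h g \<in> carrier ?T" if "g \<in> carrier G" for g
    using h(1) that by (auto simp: hom_def)
  have hm: "h (g \<otimes>\<^bsub>G\<^esub> k) = h g \<otimes>\<^bsub>?T\<^esub> h k" if "g \<in> carrier G" "k \<in> carrier G" for g k
    using h(1) that by (auto simp: hom_def)
  obtain e where e: "e \<in> lists A" "acts_as (h \<one>\<^bsub>G\<^esub>) e"
    using carrier_acts_as[OF hc[OF G.one_closed]] by blast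
  \<comment> \<open>The permutation induced by \<open>e\<close> is idempotent.\<close>
  have ee: "acts_as (h \<one>\<^bsub>G\<^esub>) (e @ e)"
    using mult_acts_as[OF e(2,2)] hm[OF G.one_closed G.one_closed] by simp
  have "run x e = x" if x: "x \<in> points" for x
  proof -
    have "run (run x e) e = run x e" using acts_as_unique[OF ee e(2) x] by simp
    then show ?thesis by (rule run_inj) (use x e(1) run_closed in auto)
  qed
  then have one: "acts_as (h \<one>\<^bsub>G\<^esub>) []" using e(2) unfolding acts_as_def by simp
  have rw: "reduce \<iota> w \<in> lists A" "reduced \<iota> (reduce \<iota> w)"
    using reduce_lists[OF w] reduced_reduce by auto
  then have "coset (reduce \<iota> w) \<in> carrier ?T" unfolding carrier_transition_group by blast
  then obtain g where g: "g \<in> carrier G" "h g = coset (reduce \<iota> w)"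
    using h(2) unfolding bij_betw_def by (metis imageE)
  have gw: "acts_as (h g) w"
    using coset_member[OF rw] coset_lists[OF rw(1)] coset_run[OF rw(1)] run_reduce[OF _ w]
    unfolding g(2) acts_as_def by auto
  have pow: "acts_as (h (g [^]\<^bsub>G\<^esub> n)) (concat (replicate n w))" for n :: nat
  proof (induction n)
    case 0
    then show ?case using one by simp
  next
    case (Suc n)
    have "h (g [^]\<^bsub>G\<^esub> Suc n) = h (g [^]\<^bsub>G\<^esub> n) \<otimes>\<^bsub>?T\<^esub> h g" using hm g(1) by simp
    moreover have "concat (replicate (Suc n) w) = concat (replicate n w) @ w"
      using arg_cong[OF replicate_append_same[of n w], of concat] by simp
    ultimately show ?case using mult_acts_as[OF Suc gw] by metis
  qed
  obtain m :: nat where m: "m > 0" "g [^]\<^bsub>G\<^esub> m = \<one>\<^bsub>G\<^esub>"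
    using G g(1) unfolding torsion_group_def by blast
  have "run x (concat (replicate m w)) = x" if "x \<in> points" for x
    using acts_as_unique[OF pow[of m] _ that, of "[]"] one m(2) by simp
  then show ?thesis using m(1) by blast
qed

lemma finite_if_torsion:
  fixes G :: "('g, 'm) monoid_scheme"
  assumes G: "torsion_group G" and iso: "G \<cong> transition_group A \<iota> \<Gamma>s"
    and cf: "\<And>\<Gamma>. \<Gamma> \<in> set \<Gamma>s \<Longrightarrow> context_free_graph \<Gamma>"
  shows "finite (carrier G)"
proof -
  have "finite (verts (base \<Gamma>))" if \<Gamma>: "\<Gamma> \<in> set \<Gamma>s" for \<Gamma>
  proof (rule complete_A_graph.finite_verts_if_pointwise_torsion[OF complete_A_graph[OF \<Gamma>] cf[OF \<Gamma>]])
    fix w v assume w: "w \<in> lists A" and v: "v \<in> verts (base \<Gamma>)"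
    then have "(\<Gamma>, v) \<in> points" using \<Gamma> unfolding points_def by blast
    moreover obtain m where "m > 0" "\<forall>x\<in>points. run x (concat (replicate m w)) = x"
      using words_torsion[OF G iso w] by blast
    ultimately have "run (\<Gamma>, v) (concat (replicate m w)) = (\<Gamma>, v)" by blast
    then show "\<exists>m>0. foldl (graph_step \<Gamma>) v (concat (replicate m w)) = v"
      using \<open>m > 0\<close> unfolding run_pair by blast
  qed
  then have "finite points" unfolding points_def by blast
  then have "finite (carrier (transition_group A \<iota> \<Gamma>s))" by (rule finite_transition_group)
  moreover obtain h where "bij_betw h (carrier G) (carrier (transition_group A \<iota> \<Gamma>s))"
    using iso unfolding is_iso_def iso_def by blast
  ultimately show ?thesis by (metis bij_betw_finite)
qed

end

lemma infinite_torsion_not_CF_TR: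
  fixes G :: "('g, 'm) monoid_scheme"
  assumes "torsion_group G" "infinite (carrier G)"
  shows "G \<notin> CF_TR TYPE('a) TYPE('v) TYPE('e)"
proof
  assume "G \<in> CF_TR TYPE('a) TYPE('v) TYPE('e)"
  then obtain A :: "'a set" and \<iota> and \<Gamma>s :: "('v, 'e, 'a) labelled_graph list" where *:
    "involutive_alphabet A \<iota>"
    "\<And>\<Gamma>. \<Gamma> \<in> set \<Gamma>s \<Longrightarrow> A_graph A \<iota> \<Gamma> \<and> complete_graph A \<Gamma> \<and> context_free_graph \<Gamma>"
    "G \<cong> transition_group A \<iota> \<Gamma>s"
    unfolding CF_TR_def by blast
  interpret complete_A_graphs A \<iota> \<Gamma>s by unfold_locales (use * in auto)
  show False using finite_if_torsion[OF assms(1) *(3)] *(2) assms(2) by blast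
qed


section \<open>The Grigorchuk group is a torsion group\<close>

text \<open>
The Klein four-group \<open>{1, b, c, d}\<close>. As an automorphism of the tree, each of its elements fixes the
first level; it acts on the left subtree as \<open>a\<close> or trivially (\<open>left_swaps\<close>), and on the right
subtree as another element of the Klein group (\<open>right_section\<close>).
\<close>

datatype klein = One | Kb | Kc | Kd

fun klein_act :: "klein \<Rightarrow> bool list \<Rightarrow> bool list" where
  "klein_act One = (\<lambda>w. w)"
| "klein_act Kb = grig_b"
| "klein_act Kc = grig_c"
| "klein_act Kd = grig_d"

fun right_section :: "klein \<Rightarrow> klein" where
  "right_section One = One"
| "right_section Kb = Kc"
| "right_section Kc = Kd"
| "right_section Kd = Kb"

fun left_swaps :: "klein \<Rightarrow> bool" where
  "left_swaps One = False"
| "left_swaps Kb = True"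
| "left_swaps Kc = True"
| "left_swaps Kd = False"

fun klein_mult :: "klein \<Rightarrow> klein \<Rightarrow> klein" where
  "klein_mult One k = k"
| "klein_mult k One = k"
| "klein_mult Kb Kb = One"
| "klein_mult Kb Kc = Kd"
| "klein_mult Kb Kd = Kc"
| "klein_mult Kc Kb = Kd"
| "klein_mult Kc Kc = One"
| "klein_mult Kc Kd = Kb"
| "klein_mult Kd Kb = Kc"
| "klein_mult Kd Kc = Kb"
| "klein_mult Kd Kd = One"

lemma klein_act_Nil [simp]: "klein_act k [] = []"
  by (cases k) auto

lemma klein_act_Cons [simp]:
  "klein_act k (x # w) =
     x # (if x then klein_act (right_section k) w else if left_swaps k then grig_a w else w)"
  by (cases k) auto

lemma grig_a_grig_a [simp]: "grig_a (grig_a w) = w"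
  by (cases w) auto

lemma right_section_mult: "right_section (klein_mult k l) = klein_mult (right_section k) (right_section l)"
  by (cases k; cases l) auto

lemma left_swaps_mult: "left_swaps (klein_mult k l) \<longleftrightarrow> left_swaps k \<noteq> left_swaps l"
  by (cases k; cases l) auto

lemma klein_act_mult: "klein_act (klein_mult k l) w = klein_act k (klein_act l w)"
proof (induction w arbitrary: k l)
  case (Cons x w)
  then show ?case by (auto simp: right_section_mult left_swaps_mult)
qed simp

lemma klein_mult_self [simp]: "klein_mult k k = One"
  by (cases k) auto

lemma klein_act_klein_act [simp]: "klein_act k (klein_act k w) = w"
  unfolding klein_act_mult[symmetric] by simp

text \<open>
The products \<open>(a k1) (a k2) ...\<close>. Up to conjugation every element of the Grigorchuk group outside
the Klein group has this form, and the number of factors is the measure for the induction.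
\<close>

fun alternating :: "klein list \<Rightarrow> bool list \<Rightarrow> bool list" where
  "alternating [] w = w"
| "alternating (k # ks) w = grig_a (klein_act k (alternating ks w))"

lemma alternating_append: "alternating (ks @ ls) w = alternating ks (alternating ls w)"
  by (induction ks) auto

lemma alternating_Nil [simp]: "alternating ks [] = []"
  by (induction ks) auto

lemma bij_involution: "(\<And>w. f (f w) = w) \<Longrightarrow> bij f"
  by (rule o_bij[of f]) auto

lemma bij_klein_act: "bij (klein_act k)"
  by (rule bij_involution) simp

lemma bij_grig_a: "bij grig_a"
  by (rule bij_involution) simp

lemma bij_alternating: "bij (alternating ks)"
proof (induction ks)
  case (Cons k ks)
  have "alternating (k # ks) = grig_a \<circ> (klein_act k \<circ> alternating ks)" by auto
  then show ?case using bij_comp[OF bij_comp[OF Cons bij_klein_act] bij_grig_a] by (simp only:)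
next
  case Nil
  have "alternating [] = id" by auto
  then show ?case by (simp only: bij_id)
qed

text \<open>
The action of \<open>alternating ks\<close> on the subtree below the letter \<open>x\<close>, again written as a product
\<open>l (a k1) (a k2) ...\<close> with \<open>l\<close> in the Klein group. The factors act from right to left, and the
first letter is flipped by each of them. So a factor contributes its right section if an even or
odd number of factors (depending on \<open>x\<close>) precede it, and otherwise \<open>a\<close> or nothing.
\<close>

fun section_form :: "bool \<Rightarrow> klein list \<Rightarrow> klein \<times> klein list" where
  "section_form x [] = (One, [])"
| "section_form x (k # ks) = (let (l, ls) = section_form x ks in
     if x \<noteq> odd (length ks) then (klein_mult (right_section k) l, ls)
     else if left_swaps k then (One, l # ls) else (l, ls))"

definition section_at :: "bool \<Rightarrow> klein list \<Rightarrow> bool list \<Rightarrow> bool list" where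
  "section_at x ks w = klein_act (fst (section_form x ks)) (alternating (snd (section_form x ks)) w)"

lemma alternating_Cons: "alternating ks (x # w) = (x \<noteq> odd (length ks)) # section_at x ks w"
  by (induction ks) (auto simp: section_at_def klein_act_mult split: prod.splits)

text \<open>
A new factor \<open>a\<close> can arise only at every other position.
\<close>

lemma length_section_le:
  "length (snd (section_form x ks)) \<le> (length ks + (if x then 0 else 1)) div 2"
proof (induction ks)
  case (Cons k ks)
  then show ?case by (cases x; cases "even (length ks)") (auto split: prod.splits elim!: evenE oddE)
qed simp

lemma length_section_append:
  "length (snd (section_form x (ks @ ls))) =
   length (snd (section_form (x \<noteq> odd (length ls)) ks)) + length (snd (section_form x ls))"
  by (induction ks) (auto split: prod.splits)

text \<open>
Each factor acts on the left subtree for exactly one of the two starting letters. This bounds the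
sections of a square of odd length, where both parities meet every factor once.
\<close>

lemma length_sections_sum:
  "length (snd (section_form x ks)) + length (snd (section_form (\<not> x) ks)) =
   length (filter left_swaps ks)"
  by (induction ks) (auto split: prod.splits)

definition torsion_map :: "('a \<Rightarrow> 'a) \<Rightarrow> bool" where
  "torsion_map f \<longleftrightarrow> (\<exists>m>0. \<forall>w. (f ^^ m) w = w)"

lemma torsion_swap:
  assumes "torsion_map (\<lambda>w. f (g w))" "surj (\<lambda>w. g (f w))"
  shows "torsion_map (\<lambda>w. g (f w))"
proof -
  let ?F = "\<lambda>w. f (g w)" and ?H = "\<lambda>w. g (f w)"
  have shift: "(?H ^^ m) (g (f w)) = g ((?F ^^ m) (f w))" for m w
    by (induction m) auto
  obtain m where m: "m > 0" "\<And>w. (?F ^^ m) w = w"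
    using assms(1) unfolding torsion_map_def by blast
  have "(?H ^^ m) w = w" for w
    using shift[of m] m(2) surjD[OF assms(2), of w] by metis
  then show ?thesis using m(1) unfolding torsion_map_def by blast
qed

lemma torsion_square: "torsion_map (\<lambda>w. f (f w)) \<Longrightarrow> torsion_map f"
proof -
  assume "torsion_map (\<lambda>w. f (f w))"
  then obtain m where m: "m > 0" "\<And>w. ((\<lambda>w. f (f w)) ^^ m) w = w"
    unfolding torsion_map_def by blast
  have "(\<lambda>w. f (f w)) = f ^^ 2" by (auto simp: numeral_2_eq_2)
  then have "(f ^^ (2 * m)) w = w" for w using m(2)[of w] by (simp add: funpow_mult mult.commute)
  then show ?thesis using m(1) unfolding torsion_map_def by (intro exI[of _ "2 * m"]) simp
qed

lemma funpow_multiple_id: "(\<And>w. (f ^^ m) w = w) \<Longrightarrow> (f ^^ (m * n)) w = w"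
proof -
  assume "\<And>w. (f ^^ m) w = w"
  then have "f ^^ m = id" by auto
  then have "(f ^^ m) ^^ n = id" by (induction n) auto
  then show ?thesis by (simp add: funpow_mult mult.commute)
qed

text \<open>
A Klein element in front of a nonempty product is moved to the end by conjugation, where it is
absorbed by the last factor.
\<close>

lemma torsion_conjugate:
  assumes "torsion_map (alternating (ks @ [klein_mult k l]))"
  shows "torsion_map (\<lambda>w. klein_act l (alternating (ks @ [k]) w))"
proof (rule torsion_swap[where f = "alternating (ks @ [k])" and g = "klein_act l"])
  have "alternating (ks @ [klein_mult k l]) = (\<lambda>w. alternating (ks @ [k]) (klein_act l w))"
    by (auto simp: alternating_append klein_act_mult)
  then show "torsion_map (\<lambda>w. alternating (ks @ [k]) (klein_act l w))" using assms by simp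
  show "surj (\<lambda>w. klein_act l (alternating (ks @ [k]) w))"
    using bij_is_surj[OF bij_comp[OF bij_alternating bij_klein_act]] by (simp add: comp_def)
qed

lemma torsion_section:
  assumes "\<And>ls. length ls < n \<Longrightarrow> torsion_map (alternating ls)"
    and "length (snd (section_form x ks)) < n"
  shows "torsion_map (section_at x ks)"
proof -
  obtain l ls where l: "section_form x ks = (l, ls)" by fastforce
  have eq: "section_at x ks = (\<lambda>w. klein_act l (alternating ls w))"
    unfolding section_at_def l by auto
  show ?thesis
  proof (cases ls rule: rev_cases)
    case Nil
    have "(section_at x ks ^^ 2) w = w" for w unfolding eq Nil by (simp add: numeral_2_eq_2)
    then show ?thesis unfolding torsion_map_def by (intro exI[of _ 2]) simp
  next
    case (snoc ls' k)
    then show ?thesis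
      unfolding eq using torsion_conjugate[of ls' k l] assms(1)[of "ls' @ [klein_mult k l]"] assms(2) l
      by simp
  qed
qed

lemma torsion_of_sections:
  assumes "even (length ks)" "torsion_map (section_at False ks)" "torsion_map (section_at True ks)"
  shows "torsion_map (alternating ks)"
proof -
  obtain m n where mn: "m > 0" "n > 0" "\<And>w. (section_at False ks ^^ m) w = w"
    "\<And>w. (section_at True ks ^^ n) w = w"
    using assms(2,3) unfolding torsion_map_def by blast
  have pow: "(alternating ks ^^ i) (x # w) = x # (section_at x ks ^^ i) w" for i x w
    by (induction i) (auto simp: alternating_Cons assms(1))
  have nil: "(alternating ks ^^ i) [] = []" for i by (induction i) auto
  have "(section_at x ks ^^ (m * n)) w = w" for x w
    using funpow_multiple_id[OF mn(3), of n w] funpow_multiple_id[OF mn(4), of m w]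
    by (cases x) (simp_all add: mult.commute)
  then have "(alternating ks ^^ (m * n)) w = w" for w
    using pow nil by (cases w) auto
  then show ?thesis using mn(1,2) unfolding torsion_map_def by (intro exI[of _ "m * n"]) simp
qed

text \<open>
An odd product swaps the subtrees, so its square acts on them as \<open>g h\<close> and \<open>h g\<close>, where \<open>g\<close>
and \<open>h\<close> map one subtree to the other. These are conjugate, so it suffices to consider one of them.
\<close>

lemma torsion_odd:
  assumes "odd (length ks)" "torsion_map (section_at False (ks @ ks))"
  shows "torsion_map (alternating ks)"
proof -
  have sq: "section_at x (ks @ ks) w = section_at (\<not> x) ks (section_at x ks w)" for x w
  proof -
    have "alternating (ks @ ks) (x # w) = alternating ks (alternating ks (x # w))"
      by (rule alternating_append)
    then show ?thesis using assms(1) by (simp add: alternating_Cons)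
  qed
  have surj: "surj (section_at True (ks @ ks))"
  proof -
    have "\<exists>w. section_at True (ks @ ks) w = v" for v
    proof -
      obtain u where u: "True # v = alternating (ks @ ks) u" using surjD[OF bij_is_surj[OF bij_alternating]] by blast
      then obtain x w where "u = x # w" by (cases u) auto
      with u show ?thesis by (auto simp: alternating_Cons)
    qed
    then show ?thesis by (metis surj_def)
  qed
  have "section_at False (ks @ ks) = (\<lambda>w. section_at True ks (section_at False ks w))"
    "section_at True (ks @ ks) = (\<lambda>w. section_at False ks (section_at True ks w))"
    using sq by auto
  then have "torsion_map (section_at True (ks @ ks))"
    using torsion_swap[of "section_at True ks" "section_at False ks"] assms(2) surj by simp
  then have "torsion_map (alternating (ks @ ks))"
    using torsion_of_sections[of "ks @ ks"] assms(2) by simp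
  moreover have "alternating (ks @ ks) = (\<lambda>w. alternating ks (alternating ks w))"
    by (auto simp: alternating_append)
  ultimately show ?thesis using torsion_square[of "alternating ks"] by simp
qed

fun evens :: "'a list \<Rightarrow> 'a list" where
  "evens [] = []"
| "evens [x] = [x]"
| "evens (x # y # zs) = x # evens zs"

lemma evens_append:
  "evens (xs @ ys) = evens xs @ (if even (length xs) then evens ys else evens (tl ys))"
  by (induction xs rule: evens.induct) (cases ys; auto)+

lemma set_evens_tl: "set (evens xs) \<union> set (evens (tl xs)) = set xs"
proof (induction xs rule: evens.induct)
  case (3 x y zs)
  then show ?case by (cases zs) auto
qed auto

lemma length_evens: "length (evens xs) = (length xs + 1) div 2"
  by (induction xs rule: evens.induct) auto

text \<open>
If all factors are \<open>b\<close> or \<open>c\<close>, then no \<open>a\<close> is lost: the section alternates strictly between \<open>a\<close>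
and the right sections of every other factor.
\<close>

lemma section_form_all_swap:
  assumes "even (length ks)" "\<forall>k\<in>set ks. left_swaps k"
  shows "fst (section_form False ks) # snd (section_form False ks) = map right_section (evens ks) @ [One]"
  using assms
proof (induction ks rule: evens.induct)
  case (3 k l ks)
  then have "even (length ks)" "left_swaps l" by auto
  moreover have "klein_mult k One = k" for k by (cases k) auto
  ultimately show ?case using 3 by (auto split: prod.splits)
qed auto

text \<open>
In this case the section of the square is as long as the original product, but each factor is
replaced by its right section: \<open>b\<close> becomes \<open>c\<close>, and \<open>c\<close> becomes \<open>d\<close>. As the length is odd, every
factor occurs at an even position of the square.
\<close>

lemma torsion_all_swap:
  assumes "odd (length ks)" "\<forall>k\<in>set ks. left_swaps k"
  shows "\<exists>ls. length ls = length ks \<and> set ls = right_section ` set ks \<and>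
    (torsion_map (alternating ls) \<longrightarrow> torsion_map (alternating ks))"
proof -
  have "evens (ks @ ks) \<noteq> []" using assms(1) length_evens[of "ks @ ks"] by (cases ks) auto
  then obtain k es where e: "evens (ks @ ks) = k # es" by (cases "evens (ks @ ks)") auto
  let ?ls = "map right_section es @ [right_section k]"
  have "set (evens (ks @ ks)) = set ks"
    using assms(1) set_evens_tl[of ks] by (simp add: evens_append)
  then have set: "set ?ls = right_section ` set ks" unfolding e by auto
  have len: "length ?ls = length ks"
    using length_evens[of "ks @ ks"] unfolding e by simp
  have "section_form False (ks @ ks) = (right_section k, map right_section es @ [One])"
    using section_form_all_swap[of "ks @ ks"] assms(2) e
    by (cases "section_form False (ks @ ks)") auto
  then have "section_at False (ks @ ks) =
      (\<lambda>w. klein_act (right_section k) (alternating (map right_section es @ [One]) w))"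
    by (auto simp: section_at_def)
  then have "torsion_map (alternating ?ls) \<Longrightarrow> torsion_map (alternating ks)"
    using torsion_conjugate[of "map right_section es" One "right_section k"] torsion_odd[OF assms(1)]
    by simp
  then show ?thesis using len set by blast
qed

text \<open>
For even length the sections have about half the length. For odd length the section of the square
is shorter if some factor is \<open>1\<close> or \<open>d\<close>. Otherwise it has the same length; if some factor is \<open>c\<close>,
then the section contains \<open>d\<close>, and if all factors are \<open>b\<close>, then it contains \<open>c\<close>. So after at most two
such steps the length decreases.
\<close>

lemma torsion_alternating: "torsion_map (alternating ks)"
proof (induction "length ks" arbitrary: ks rule: less_induct)
  case less
  show ?case
  proof (cases "even (length ks)")
    case True
    show ?thesis
    proof (cases "ks = []")
      case True
      then show ?thesis unfolding torsion_map_def by (intro exI[of _ 1]) simp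
    next
      case False
      then have "length ks \<ge> 2" using \<open>even (length ks)\<close> by (cases ks; cases "tl ks") auto
      then have "length (snd (section_form x ks)) < length ks" for x
        using length_section_le[of x ks] by (cases x) auto
      then show ?thesis
        using torsion_of_sections[OF True] torsion_section[of "length ks"] less by blast
    qed
  next
    case False
    have short: "torsion_map (alternating ls)" if "length ls = length ks" "\<exists>k\<in>set ls. \<not> left_swaps k" for ls
    proof -
      have odd: "odd (length ls)" using False that(1) by simp
      have "length (snd (section_form False (ls @ ls))) = length (filter left_swaps ls)"
        using length_section_append[of False ls ls] length_sections_sum[of False ls] odd by simp
      also have "\<dots> < length ls" using that(2) by (metis length_filter_less)
      finally show ?thesis
        using torsion_odd[OF odd] torsion_section[of "length ks" False "ls @ ls"] less that(1) by simp
    qed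
    have with_c: "torsion_map (alternating ls)" if ls: "length ls = length ks" "Kc \<in> set ls" for ls
    proof (cases "\<forall>k\<in>set ls. left_swaps k")
      case True
      have odd: "odd (length ls)" using False ls(1) by simp
      obtain ms where "length ms = length ls" "set ms = right_section ` set ls"
        "torsion_map (alternating ms) \<longrightarrow> torsion_map (alternating ls)"
        using torsion_all_swap[OF odd True] by blast
      moreover have "Kd \<in> right_section ` set ls" using ls(2) by force
      ultimately show ?thesis using short[of ms] ls(1) by force
    qed (use short ls in blast)
    show ?thesis
    proof (cases "\<forall>k\<in>set ks. left_swaps k")
      case True
      obtain ms where ms: "length ms = length ks" "set ms = right_section ` set ks"
        "torsion_map (alternating ms) \<longrightarrow> torsion_map (alternating ks)"
        using torsion_all_swap[OF False True] by blast
      show ?thesis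
      proof (cases "Kc \<in> set ks")
        case True
        then show ?thesis using with_c by blast
      next
        case no_c: False
        obtain k where k: "k \<in> set ks" using False by (metis even_zero last_in_set list.size(3))
        moreover from k have "left_swaps k" using True by blast
        moreover from k have "k \<noteq> Kc" using no_c by blast
        ultimately have "Kb \<in> set ks" by (cases k rule: klein.exhaust) auto
        then have "Kc \<in> set ms" unfolding ms(2) by force
        then show ?thesis using with_c ms by blast
      qed
    qed (use short in blast)
  qed
qed

definition normal_forms :: "(bool list \<Rightarrow> bool list) set" where
  "normal_forms = {\<lambda>w. klein_act k (alternating ks w) |k ks. True}"

lemma torsion_normal_form: "f \<in> normal_forms \<Longrightarrow> torsion_map f"
proof -
  assume "f \<in> normal_forms"
  then obtain k ks where f: "f = (\<lambda>w. klein_act k (alternating ks w))" unfolding normal_forms_def by blast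
  show ?thesis
  proof (cases ks rule: rev_cases)
    case Nil
    have "(f ^^ 2) w = w" for w unfolding f Nil by (simp add: numeral_2_eq_2)
    then show ?thesis unfolding torsion_map_def by (intro exI[of _ 2]) simp
  next
    case (snoc ls l)
    then show ?thesis unfolding f using torsion_conjugate torsion_alternating by blast
  qed
qed

lemma klein_act_normal_form: "klein_act k \<in> normal_forms"
proof -
  have "klein_act k = (\<lambda>w. klein_act k (alternating [] w))" by simp
  then show ?thesis unfolding normal_forms_def by blast
qed

lemma grig_a_normal_form: "grig_a \<in> normal_forms"
proof -
  have "grig_a = (\<lambda>w. klein_act One (alternating [One] w))" by simp
  then show ?thesis unfolding normal_forms_def by blast
qed

lemma normal_forms_comp:
  assumes "f \<in> normal_forms" "g \<in> normal_forms"
  shows "(\<lambda>w. f (g w)) \<in> normal_forms"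
proof -
  obtain k ks l ls where *: "f = (\<lambda>w. klein_act k (alternating ks w))"
    "g = (\<lambda>w. klein_act l (alternating ls w))"
    using assms unfolding normal_forms_def by blast
  show ?thesis
  proof (cases ks rule: rev_cases)
    case Nil
    then have "(\<lambda>w. f (g w)) = (\<lambda>w. klein_act (klein_mult k l) (alternating ls w))"
      unfolding * by (simp add: klein_act_mult)
    then show ?thesis unfolding normal_forms_def by blast
  next
    case (snoc ks' k')
    then have "(\<lambda>w. f (g w)) = (\<lambda>w. klein_act k (alternating (ks' @ [klein_mult k' l] @ ls) w))"
      unfolding * by (simp add: klein_act_mult alternating_append)
    then show ?thesis unfolding normal_forms_def by blast
  qed
qed

lemma Bij_UNIV: "Bij UNIV = {f. bij f}"
  unfolding Bij_def by auto

lemma mult_BijGroup_UNIV: "bij f \<Longrightarrow> bij g \<Longrightarrow> f \<otimes>\<^bsub>BijGroup UNIV\<^esub> g = (\<lambda>w. f (g w))"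
  unfolding BijGroup_def by (auto simp: Bij_UNIV compose_def)

lemma one_BijGroup_UNIV: "\<one>\<^bsub>BijGroup UNIV\<^esub> = (\<lambda>w. w)"
  unfolding BijGroup_def by (auto simp: restrict_def)

lemma carrier_BijGroup_UNIV: "carrier (BijGroup UNIV) = {f. bij f}"
  unfolding BijGroup_def by (simp add: Bij_UNIV)

lemma bij_normal_form: "f \<in> normal_forms \<Longrightarrow> bij f"
  unfolding normal_forms_def using bij_comp[OF bij_alternating bij_klein_act] by (auto simp: comp_def)

abbreviation "grig_generators \<equiv> {grig_a, grig_b, grig_c, grig_d}"

lemma generators_involution: "g \<in> grig_generators \<Longrightarrow> g (g w) = w"
  using grig_a_grig_a[of w] klein_act_klein_act[of Kb w, unfolded klein_act.simps]
    klein_act_klein_act[of Kc w, unfolded klein_act.simps]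
    klein_act_klein_act[of Kd w, unfolded klein_act.simps] by blast

lemma generators_normal_form: "g \<in> grig_generators \<Longrightarrow> g \<in> normal_forms"
  using grig_a_normal_form klein_act_normal_form[of Kb, unfolded klein_act.simps]
    klein_act_normal_form[of Kc, unfolded klein_act.simps]
    klein_act_normal_form[of Kd, unfolded klein_act.simps] by blast

lemma carrier_grigorchuk_group: "carrier grigorchuk_group = generate (BijGroup UNIV) grig_generators"
proof -
  have "bij g" if "g \<in> grig_generators" for g
    using generators_involution[OF that] by (rule bij_involution)
  then have "carrier (BijGroup UNIV) \<inter> grig_generators = grig_generators"
    unfolding carrier_BijGroup_UNIV by blast
  then show ?thesis unfolding grigorchuk_group_def carrier_subgroup_generated by simp
qed

lemma grigorchuk_group_elements: "carrier grigorchuk_group = normal_forms"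
proof
  interpret B: group "BijGroup (UNIV :: bool list set)" by (rule group_BijGroup)
  show "carrier grigorchuk_group \<subseteq> normal_forms"
  proof
    fix g assume "g \<in> carrier grigorchuk_group"
    then have "g \<in> generate (BijGroup UNIV) grig_generators" unfolding carrier_grigorchuk_group .
    then show "g \<in> normal_forms"
    proof (induction rule: generate.induct)
      case one
      then show ?case using klein_act_normal_form[of One] unfolding one_BijGroup_UNIV by simp
    next
      case (incl h)
      then show ?case by (rule generators_normal_form)
    next
      case (inv h)
      have "bij h" using generators_involution[OF inv] by (rule bij_involution)
      then have "inv\<^bsub>BijGroup UNIV\<^esub> h = h"
        by (intro B.inv_equality)
          (auto simp: mult_BijGroup_UNIV one_BijGroup_UNIV carrier_BijGroup_UNIV generators_involution[OF inv])
      then show ?case using generators_normal_form[OF inv] by simp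
    next
      case (eng h1 h2)
      then show ?case using normal_forms_comp[of h1 h2] by (simp add: mult_BijGroup_UNIV bij_normal_form)
    qed
  qed
  let ?H = "generate (BijGroup UNIV) grig_generators"
  have mult: "(\<lambda>w. f (g w)) \<in> ?H" if "f \<in> ?H" "g \<in> ?H" "bij f" "bij g" for f g
    using generate.eng[OF that(1,2)] mult_BijGroup_UNIV[OF that(3,4)] by simp
  have klein: "klein_act k \<in> ?H" for k
    using generate.one[of "BijGroup UNIV" grig_generators]
    by (cases k) (auto simp: one_BijGroup_UNIV intro: generate.incl)
  have a: "grig_a \<in> ?H" by (rule generate.incl) simp
  have "alternating ks \<in> ?H" for ks
  proof (induction ks)
    case Nil
    have "alternating [] = klein_act One" by auto
    then show ?case using klein by metis
  next
    case (Cons k ks)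
    have "(\<lambda>w. klein_act k (alternating ks w)) \<in> ?H"
      using mult[OF klein Cons bij_klein_act bij_alternating] .
    moreover have "bij (\<lambda>w. klein_act k (alternating ks w))"
      using bij_comp[OF bij_alternating bij_klein_act] by (simp add: comp_def)
    ultimately have "(\<lambda>w. grig_a (klein_act k (alternating ks w))) \<in> ?H"
      using mult[OF a _ bij_grig_a] by blast
    moreover have "alternating (k # ks) = (\<lambda>w. grig_a (klein_act k (alternating ks w)))" by auto
    ultimately show ?case by simp
  qed
  then show "normal_forms \<subseteq> carrier grigorchuk_group"
    unfolding normal_forms_def carrier_grigorchuk_group
    using mult[OF klein _ bij_klein_act bij_alternating] by blast
qed

lemma torsion_group_grigorchuk: "torsion_group grigorchuk_group"
proof -
  interpret B: group "BijGroup (UNIV :: bool list set)" by (rule group_BijGroup)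
  interpret G: group grigorchuk_group
    unfolding grigorchuk_group_def by (rule B.group_subgroup_generated)
  have pow: "g [^]\<^bsub>grigorchuk_group\<^esub> n = g ^^ n" if g: "g \<in> carrier grigorchuk_group" for g and n :: nat
  proof (induction n)
    case 0
    show ?case by (auto simp: grigorchuk_group_def one_BijGroup_UNIV)
  next
    case (Suc n)
    have bij: "bij g" using g bij_normal_form unfolding grigorchuk_group_elements by blast
    have "g [^]\<^bsub>grigorchuk_group\<^esub> Suc n = (g ^^ n) \<otimes>\<^bsub>BijGroup UNIV\<^esub> g"
      using Suc by (simp add: grigorchuk_group_def)
    also have "\<dots> = g ^^ Suc n"
      by (auto simp: mult_BijGroup_UNIV bij bij_fn funpow_swap1)
    finally show ?case .
  qed
  have "\<exists>n>0. g [^]\<^bsub>grigorchuk_group\<^esub> (n :: nat) = \<one>\<^bsub>grigorchuk_group\<^esub>"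
    if g: "g \<in> carrier grigorchuk_group" for g
  proof -
    have "torsion_map g" using torsion_normal_form g unfolding grigorchuk_group_elements .
    then obtain n where "n > 0" "g ^^ n = (\<lambda>w. w)" unfolding torsion_map_def by blast
    then show ?thesis using pow[OF g] by (auto simp: grigorchuk_group_def one_BijGroup_UNIV)
  qed
  then show ?thesis unfolding torsion_group_def using G.group_axioms by blast
qed

section \<open>The Grigorchuk group is infinite\<close>

lemma grig_a_prefix: "\<exists>v'. grig_a (u @ v) = grig_a u @ v' \<and> length v' = length v"
  by (cases u; cases v) auto

lemma klein_act_prefix: "\<exists>v'. klein_act k (u @ v) = klein_act k u @ v' \<and> length v' = length v"
proof (induction u arbitrary: k)
  case Nil
  have "length (grig_a w) = length w" for w by (cases w) auto
  then have "length (klein_act k v) = length v" by (induction v arbitrary: k) auto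
  then show ?case by simp
next
  case (Cons x u)
  then show ?case using grig_a_prefix[of u v] by auto
qed

lemma normal_form_prefix:
  assumes "f \<in> normal_forms"
  shows "\<exists>v'. f (u @ v) = f u @ v' \<and> length v' = length v"
proof -
  have "\<exists>v'. alternating ks (u @ v) = alternating ks u @ v' \<and> length v' = length v" for ks
  proof (induction ks)
    case (Cons k ks)
    then obtain v1 where v1: "alternating ks (u @ v) = alternating ks u @ v1" "length v1 = length v" by blast
    obtain v2 where v2: "klein_act k (alternating ks u @ v1) = klein_act k (alternating ks u) @ v2"
      "length v2 = length v1" using klein_act_prefix by blast
    show ?case
      using v1 v2 grig_a_prefix[of "klein_act k (alternating ks u)" v2] by auto
  qed simp
  note alternating_prefix = this
  obtain k ks where f: "f = (\<lambda>w. klein_act k (alternating ks w))"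
    using assms unfolding normal_forms_def by blast
  obtain v1 where v1: "alternating ks (u @ v) = alternating ks u @ v1" "length v1 = length v"
    using alternating_prefix by blast
  then show ?thesis using klein_act_prefix[of k "alternating ks u" v1] unfolding f by auto
qed

text \<open>
Along the path \<open>1 1 1 ...\<close> the elements \<open>b\<close>, \<open>c\<close>, \<open>d\<close> are permuted cyclically, so for every \<open>n\<close>
one of them acts as \<open>a\<close> below the vertex \<open>1^n 0\<close>.
\<close>

lemma flip_below: "\<exists>k. \<forall>w. klein_act k (replicate n True @ False # w) = replicate n True @ False # grig_a w"
proof (induction n)
  case 0
  show ?case by (intro exI[of _ Kb]) auto
next
  case (Suc n)
  then obtain k where k: "\<And>w. klein_act k (replicate n True @ False # w) = replicate n True @ False # grig_a w"
    by blast
  obtain l where l: "right_section l = k" using right_section.simps by (cases k) blast+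
  show ?case using k l by (intro exI[of _ l]) auto
qed

text \<open>
Move the parents to the vertex \<open>1^m 0\<close>, where the last letter can be flipped if necessary.
\<close>

lemma level_transitive:
  assumes "length u = n" "length v = n"
  shows "\<exists>f\<in>normal_forms. f u = v"
  using assms
proof (induction n arbitrary: u v)
  case 0
  then show ?case using klein_act_normal_form[of One] by auto
next
  case (Suc n)
  obtain u' x where u: "u = u' @ [x]" "length u' = n" using Suc.prems(1) by (cases u rule: rev_cases) auto
  obtain v' y where v: "v = v' @ [y]" "length v' = n" using Suc.prems(2) by (cases v rule: rev_cases) auto
  show ?case
  proof (cases n)
    case 0
    show ?thesis
    proof (cases "x = y")
      case True
      then have "klein_act One u = v" using 0 u v by simp
      then show ?thesis using klein_act_normal_form by blast
    next
      case False
      then have "grig_a u = v" using 0 u v by simp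
      then show ?thesis using grig_a_normal_form by blast
    qed
  next
    case (Suc m)
    let ?p = "replicate m True @ [False]"
    have p: "length ?p = n" using Suc by simp
    obtain f where f: "f \<in> normal_forms" "f u' = ?p" using Suc.IH[OF u(2) p] by blast
    obtain g where g: "g \<in> normal_forms" "g ?p = v'" using Suc.IH[OF p v(2)] by blast
    obtain x' where x': "f u = ?p @ [x']"
      using normal_form_prefix[OF f(1), of u' "[x]"] f(2) u(1) by (auto simp: length_Suc_conv)
    have gz: "\<exists>z'. g (?p @ [z]) = v' @ [z']" for z
      using normal_form_prefix[OF g(1), of ?p "[z]"] g(2) by (auto simp: length_Suc_conv)
    have inj: "g (?p @ [True]) \<noteq> g (?p @ [False])"
      using injD[OF bij_is_inj[OF bij_normal_form[OF g(1)]], of "?p @ [True]" "?p @ [False]"] by auto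
    obtain z1 z2 where z12: "g (?p @ [True]) = v' @ [z1]" "g (?p @ [False]) = v' @ [z2]"
      using gz by blast
    have "\<exists>z. g (?p @ [z]) = v"
    proof (cases "z1 = y")
      case True
      then show ?thesis using z12 v(1) by blast
    next
      case False
      then have "z2 = y" using inj z12 by auto
      then show ?thesis using z12 v(1) by blast
    qed
    then obtain z where z: "g (?p @ [z]) = v" by blast
    show ?thesis
    proof (cases "x' = z")
      case True
      then have "g (f u) = v" using x' z by simp
      then show ?thesis by (rule bexI[OF _ normal_forms_comp[OF g(1) f(1)]])
    next
      case False
      obtain k where k: "\<And>w. klein_act k (replicate m True @ False # w) = replicate m True @ False # grig_a w"
        using flip_below by blast
      then have "klein_act k (f u) = ?p @ [z]" using x' False by simp
      then have "g (klein_act k (f u)) = v" using z by simp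
      then show ?thesis
        by (rule bexI[OF _ normal_forms_comp[OF g(1) normal_forms_comp[OF klein_act_normal_form f(1)]]])
    qed
  qed
qed

lemma infinite_grigorchuk: "infinite (carrier grigorchuk_group)"
proof
  assume "finite (carrier grigorchuk_group)"
  then have fin: "finite normal_forms" unfolding grigorchuk_group_elements .
  define n where "n = card normal_forms"
  have "{w :: bool list. length w = n} \<subseteq> (\<lambda>f. f (replicate n False)) ` normal_forms"
  proof
    fix w :: "bool list" assume "w \<in> {w. length w = n}"
    then obtain f where "f \<in> normal_forms" "f (replicate n False) = w"
      using level_transitive[of "replicate n False" n w] by auto
    then show "w \<in> (\<lambda>f. f (replicate n False)) ` normal_forms" by blast
  qed
  then have "card {w :: bool list. length w = n} \<le> n"
    unfolding n_def by (rule surj_card_le[OF fin])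
  moreover have "card {w :: bool list. length w = n} = 2 ^ n"
    using card_lists_length_eq[of "UNIV :: bool set" n] by simp
  ultimately show False using less_exp[of n] by simp
qed


section \<open>Infinite torsion groups are not in the class\<close>

theorem corollary5p9:
  shows "(\<forall>G :: ('g, 'm) monoid_scheme.
            torsion_group G \<and> infinite (carrier G) \<longrightarrow>
              G \<notin> CF_TR TYPE('a) TYPE('v) TYPE('e)) \<and>
         grigorchuk_group \<notin> CF_TR TYPE('a) TYPE('v) TYPE('e)"
  using infinite_torsion_not_CF_TR infinite_torsion_not_CF_TR[OF torsion_group_grigorchuk infinite_grigorchuk]
  by blast

end
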